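(* Let $f\in\mathbb{K}[y_1,\dots,y_k]$ be a monomial of degree $d$ in $k$ variables. For each $n\ge k$, let $I_n$ be the kernel of the (toric) map $$\phi_n:R_n\to T_n,\qquad x_{(u_1,\dots,u_k)}\mapsto f(t_{u_1},\dots,t_{u_k}),$$ and let $I_n^{\pm}$ be the corresponding Laurent ideal. There is an effective algorithm to compute a finite set of generators for the invariant chains $I_\circ^{\pm}=I_k^{\pm}\subseteq I_{k+1}^{\pm}\subseteq\cdots$ of Laurent ideals arising in this way.
   Context: $\mathbb{K}$ is a field and $k\ge 1$ is an integer. Let $[n]=\{1,\dots,n\}$ and let $\langle n\rangle^k$ be the set of ordered $k$-tuples $u=(u_1,\dots,u_k)$ of pairwise distinct elements of $[n]$. $R_n=\mathbb{K}[x_u : u\in\langle n\rangle^k]$ and $T_n=\mathbb{K}[t_1,\dots,t_n]$ are polynomial rings, with $R_n\subseteq R_m$ for $n\le m$; $\phi_n$ is a homomorphism of $\mathbb{K}$-algebras. $R_n^{\pm}$ is the localization of $R_n$ at the multiplicative set of all its monomials (the Laurent polynomial ring), and for an ideal $I\subseteq R_n$, the corresponding Laurent ideal is $I^{\pm}=\{gh^{-1}: g\in I,\ h\text{ a monomial of }R_n\}\subseteq R_n^{\pm}$. The symmetric group $\mathfrak{S}_m$ of $[m]$ acts on $\langle m\rangle^k$ by $\sigma(u_1,\dots,u_k)=(\sigma(u_1),\dots,\sigma(u_k))$ and on $R_m$ and $R_m^{\pm}$ by $\mathbb{K}$-algebra automorphisms with $\sigma x_u=x_{\sigma u}$. A chain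 of ideals $J_n\subseteq R_n^{\pm}$ with $J_n\subseteq J_{n+1}$ is invariant if $\mathfrak{S}_mJ_n=\{\sigma g:\sigma\in\mathfrak{S}_m,\ g\in J_n\}\subseteq J_m$ for all $m\ge n$. An integer $N$ is a stabilization bound for an invariant chain if for all $m\ge N$ the ideal of $R_m^{\pm}$ generated by $\mathfrak{S}_mJ_N$ equals $J_m$; in that case, generators of the ideal $J_N$ are called generators for the chain. *)

theory Defs
  imports
    "HOL-Library.Poly_Mapping"
    "HOL-Library.Nat_Bijection"
    "HOL-Combinatorics.Permutations"
    "HOL-Algebra.Ideal"
    "HOL-Algebra.RingHom"
begin

section \<open>Polynomial and Laurent polynomial rings\<close>

text \<open>
  With convolution as multiplication, \<open>('v \<Rightarrow>\<^sub>0 nat) \<Rightarrow>\<^sub>0 'a\<close> is the polynomial ring and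
  \<open>('v \<Rightarrow>\<^sub>0 int) \<Rightarrow>\<^sub>0 'a\<close> the Laurent polynomial ring over \<open>'a\<close> with one variable for each
  element of \<open>'v\<close>: keys are exponent vectors, values are coefficients.  The rings in finitely many
  variables are the subrings of those elements in which only variables from \<open>V\<close> occur; in
  particular the inclusions for growing \<open>V\<close> are inclusions of sets.
\<close>

type_synonym ('v, 'a) mpoly = "('v \<Rightarrow>\<^sub>0 nat) \<Rightarrow>\<^sub>0 'a"
type_synonym ('v, 'a) lpoly = "('v \<Rightarrow>\<^sub>0 int) \<Rightarrow>\<^sub>0 'a"

definition ring_in_vars :: "'v set \<Rightarrow> (('v \<Rightarrow>\<^sub>0 'e::comm_monoid_add) \<Rightarrow>\<^sub>0 'a::comm_ring_1) ring" where
  "ring_in_vars V =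
     \<lparr>carrier = {p. \<forall>m\<in>Poly_Mapping.keys p. Poly_Mapping.keys m \<subseteq> V},
      monoid.mult = (*), one = 1, zero = 0, add = (+)\<rparr>"

definition poly_ring :: "'v set \<Rightarrow> ('v, 'a::field) mpoly ring" where
  "poly_ring V = ring_in_vars V"

definition laurent_ring :: "'v set \<Rightarrow> ('v, 'a::field) lpoly ring" where
  "laurent_ring V = ring_in_vars V"

lemma cring_ring_in_vars:
  "cring (ring_in_vars V :: (('v \<Rightarrow>\<^sub>0 'e::comm_monoid_add) \<Rightarrow>\<^sub>0 'a::comm_ring_1) ring)"
proof -
  let ?R = "ring_in_vars V :: (('v \<Rightarrow>\<^sub>0 'e) \<Rightarrow>\<^sub>0 'a) ring"
  have in_carrier: "p \<in> carrier ?R \<longleftrightarrow> (\<forall>m\<in>Poly_Mapping.keys p. Poly_Mapping.keys m \<subseteq> V)" for p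
    by (simp add: ring_in_vars_def)
  have add: "p + q \<in> carrier ?R" if "p \<in> carrier ?R" "q \<in> carrier ?R" for p q
    using that Poly_Mapping.keys_add[of p q] unfolding in_carrier by blast
  have mult: "p * q \<in> carrier ?R" if pq: "p \<in> carrier ?R" "q \<in> carrier ?R" for p q
    unfolding in_carrier
  proof
    fix m assume "m \<in> Poly_Mapping.keys (p * q)"
    then obtain a b where "m = a + b" "a \<in> Poly_Mapping.keys p" "b \<in> Poly_Mapping.keys q"
      using Poly_Mapping.keys_mult[of p q] by blast
    moreover from this have "Poly_Mapping.keys a \<subseteq> V" "Poly_Mapping.keys b \<subseteq> V"
      using pq unfolding in_carrier by blast+
    ultimately show "Poly_Mapping.keys m \<subseteq> V"
      using Poly_Mapping.keys_add[of a b] by blast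
  qed
  have neg: "- p \<in> carrier ?R" if "p \<in> carrier ?R" for p
    using that unfolding in_carrier by simp
  have zero: "0 \<in> carrier ?R" and one: "1 \<in> carrier ?R"
    by (simp_all add: in_carrier)
  have ops: "(\<oplus>\<^bsub>?R\<^esub>) = (+)" "(\<otimes>\<^bsub>?R\<^esub>) = (*)" "\<zero>\<^bsub>?R\<^esub> = 0" "\<one>\<^bsub>?R\<^esub> = 1"
    by (simp_all add: ring_in_vars_def)
  have "abelian_group ?R"
  proof (rule abelian_groupI, unfold ops)
    show "\<exists>y\<in>carrier ?R. y + x = 0" if "x \<in> carrier ?R" for x
      using neg[OF that] by (intro bexI[of _ "- x"]) simp
  qed (simp_all add: add zero add_ac)
  moreover have "comm_monoid ?R"
    by (rule comm_monoidI, unfold ops) (simp_all add: mult one mult_ac)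
  ultimately show ?thesis
    by (rule cringI, unfold ops) (simp add: distrib_right)
qed

section \<open>Substitution homomorphisms\<close>

definition const :: "'a::zero \<Rightarrow> ('v, 'a) mpoly" where
  "const c = Poly_Mapping.single 0 c"

definition var :: "'v \<Rightarrow> ('v, 'a::zero_neq_one) mpoly" where
  "var v = Poly_Mapping.single (Poly_Mapping.single v 1) 1"

definition substitute :: "('v \<Rightarrow> ('w, 'a) mpoly) \<Rightarrow> ('v, 'a::field) mpoly \<Rightarrow> ('w, 'a) mpoly" where
  "substitute g p =
     (\<Sum>m\<in>Poly_Mapping.keys p.
        const (Poly_Mapping.lookup p m) * (\<Prod>v\<in>Poly_Mapping.keys m. g v ^ Poly_Mapping.lookup m v))"

lemma poly_mapping_add_induct [case_names zero add single]:
  fixes p :: "'b \<Rightarrow>\<^sub>0 'a::comm_monoid_add"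
  assumes "P 0" "\<And>p q. P p \<Longrightarrow> P q \<Longrightarrow> P (p + q)" "\<And>m c. P (Poly_Mapping.single m c)"
  shows "P p"
proof -
  have "P (\<Sum>m\<in>A. Poly_Mapping.single m (Poly_Mapping.lookup p m))" if "finite A" for A
    using that by (induction A rule: finite_induct) (simp_all add: assms)
  moreover have "p = (\<Sum>m\<in>Poly_Mapping.keys p. Poly_Mapping.single m (Poly_Mapping.lookup p m))"
    by (rule poly_mapping_eqI)
      (simp add: lookup_sum lookup_single when_def sum.delta in_keys_iff)
  ultimately show ?thesis
    by (metis finite_keys)
qed

lemma substitute_ring_hom:
  fixes g :: "'v \<Rightarrow> ('w, 'a::field) mpoly"
  assumes g: "\<And>v. v \<in> V \<Longrightarrow> g v \<in> carrier (poly_ring W)"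
  shows "substitute g \<in> ring_hom (poly_ring V) (poly_ring W)"
proof -
  let ?C = "carrier (poly_ring W) :: ('w, 'a) mpoly set"
  interpret W: cring "poly_ring W :: ('w, 'a) mpoly ring"
    unfolding poly_ring_def by (rule cring_ring_in_vars)
  have ops: "(\<oplus>\<^bsub>poly_ring U\<^esub>) = (+)" "(\<otimes>\<^bsub>poly_ring U\<^esub>) = (*)" "\<zero>\<^bsub>poly_ring U\<^esub> = 0"
    "\<one>\<^bsub>poly_ring U\<^esub> = 1" for U :: "'c set"
    by (simp_all add: poly_ring_def ring_in_vars_def)
  have C_sum: "sum h A \<in> ?C" if "\<And>i. i \<in> A \<Longrightarrow> h i \<in> ?C" for h and A :: "('v \<Rightarrow>\<^sub>0 nat) set"
    using that W.zero_closed W.a_closed unfolding ops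
    by (induction A rule: infinite_finite_induct) simp_all
  have C_prod: "prod h A \<in> ?C" if "\<And>i. i \<in> A \<Longrightarrow> h i \<in> ?C" for h and A :: "'v set"
    using that W.one_closed W.m_closed unfolding ops
    by (induction A rule: infinite_finite_induct) simp_all
  have C_power: "a ^ n \<in> ?C" if "a \<in> ?C" for a n
    using that W.one_closed W.m_closed unfolding ops by (induction n) simp_all
  have C_const: "const c \<in> ?C" for c
    by (simp add: const_def poly_ring_def ring_in_vars_def)
  define M where "M m = (\<Prod>v\<in>Poly_Mapping.keys m. g v ^ Poly_Mapping.lookup m v)" for m
  have M_sup: "M m = (\<Prod>v\<in>A. g v ^ Poly_Mapping.lookup m v)"
    if "finite A" "Poly_Mapping.keys m \<subseteq> A" for A m
    unfolding M_def using that by (intro prod.mono_neutral_left) (auto simp: in_keys_iff)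
  have M_add: "M (a + b) = M a * M b" for a b
  proof -
    let ?A = "Poly_Mapping.keys a \<union> Poly_Mapping.keys b"
    show ?thesis
      using M_sup[of ?A a] M_sup[of ?A b] M_sup[of ?A "a + b"] Poly_Mapping.keys_add[of a b]
      by (simp add: lookup_add power_add prod.distrib)
  qed
  have S_sup: "substitute g p = (\<Sum>m\<in>A. const (Poly_Mapping.lookup p m) * M m)"
    if "finite A" "Poly_Mapping.keys p \<subseteq> A" for A p
    unfolding substitute_def M_def[symmetric] using that
    by (intro sum.mono_neutral_left) (auto simp: in_keys_iff const_def)
  have S_add: "substitute g (p + q) = substitute g p + substitute g q" for p q
  proof -
    let ?A = "Poly_Mapping.keys p \<union> Poly_Mapping.keys q"
    show ?thesis
      using S_sup[of ?A p] S_sup[of ?A q] S_sup[of ?A "p + q"] Poly_Mapping.keys_add[of p q]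
      by (simp add: lookup_add const_def single_add distrib_right sum.distrib)
  qed
  have S_single: "substitute g (Poly_Mapping.single m c) = const c * M m" for m c
    using S_sup[of "{m}" "Poly_Mapping.single m c"] by simp
  have S_0: "substitute g 0 = 0"
    by (simp add: substitute_def)
  have S_mult_single: "substitute g (p * Poly_Mapping.single m c) =
      substitute g p * substitute g (Poly_Mapping.single m c)" for p m c
  proof (induction p rule: poly_mapping_add_induct)
    case (single n b)
    have "(const (b * c) :: ('w, 'a) mpoly) = const b * const c"
      by (simp add: const_def mult_single)
    then show ?case
      by (simp add: mult_single S_single M_add mult_ac)
  qed (simp_all add: S_0 S_add distrib_right)
  have S_mult: "substitute g (p * q) = substitute g p * substitute g q" for p q
    by (induction q rule: poly_mapping_add_induct)
      (simp_all add: S_0 S_add distrib_left S_mult_single)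
  have S_1: "substitute g 1 = 1"
    using S_single[of 0 1] by (simp add: const_def M_def)
  have closed: "substitute g p \<in> ?C" if p: "p \<in> carrier (poly_ring V)" for p
    unfolding substitute_def
  proof (rule C_sum)
    fix m assume "m \<in> Poly_Mapping.keys p"
    then have "v \<in> V" if "v \<in> Poly_Mapping.keys m" for v
      using p that by (auto simp: poly_ring_def ring_in_vars_def)
    then have "(\<Prod>v\<in>Poly_Mapping.keys m. g v ^ Poly_Mapping.lookup m v) \<in> ?C"
      by (intro C_prod C_power g)
    then show "const (Poly_Mapping.lookup p m) *
        (\<Prod>v\<in>Poly_Mapping.keys m. g v ^ Poly_Mapping.lookup m v) \<in> ?C"
      using W.m_closed[OF C_const] unfolding ops by simp
  qed
  show ?thesis
    by (rule ring_hom_memI) (simp_all add: closed ops S_add S_mult S_1)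
qed

section \<open>The toric maps and their kernels\<close>

definition tuples :: "nat \<Rightarrow> nat \<Rightarrow> nat list set" where
  "tuples k n = {u. length u = k \<and> distinct u \<and> set u \<subseteq> {1..n}}"

text \<open>The monomial in \<open>y\<^sub>1, \<dots>, y\<^sub>k\<close> with exponents \<open>\<alpha> = [\<alpha>\<^sub>1, \<dots>, \<alpha>\<^sub>k]\<close>; the list is indexed from 0.\<close>
definition monomial_of :: "nat list \<Rightarrow> (nat, 'a::field) mpoly" where
  "monomial_of \<alpha> = (\<Prod>i<length \<alpha>. var (Suc i) ^ (\<alpha> ! i))"

text \<open>\<open>x\<^sub>u \<mapsto> f (t\<^bsub>u\<^sub>1\<^esub>, \<dots>, t\<^bsub>u\<^sub>k\<^esub>)\<close>; the same formula serves all \<open>n\<close>, only the rings change.\<close>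
definition toric_map :: "(nat, 'a::field) mpoly \<Rightarrow> (nat list, 'a) mpoly \<Rightarrow> (nat, 'a) mpoly" where
  "toric_map f = substitute (\<lambda>u. substitute (\<lambda>i. var (u ! (i - 1))) f)"

lemma toric_map_ring_hom:
  fixes f :: "(nat, 'a::field) mpoly"
  assumes f: "f \<in> carrier (poly_ring {1..k})"
  shows "toric_map f \<in> ring_hom (poly_ring (tuples k n)) (poly_ring {1..n})"
  unfolding toric_map_def
proof (rule substitute_ring_hom)
  fix u assume u: "u \<in> tuples k n"
  have "(var (u ! (i - 1)) :: (nat, 'a) mpoly) \<in> carrier (poly_ring {1..n})"
    if i: "i \<in> {1..k}" for i
  proof -
    have "u ! (i - 1) \<in> set u"
      using u i by (intro nth_mem) (auto simp: tuples_def)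
    then have "u ! (i - 1) \<in> {1..n}"
      using u by (auto simp: tuples_def)
    then show ?thesis
      by (simp add: var_def poly_ring_def ring_in_vars_def)
  qed
  then show "substitute (\<lambda>i. var (u ! (i - 1))) f \<in> carrier (poly_ring {1..n})"
    by (rule ring_hom_closed[OF substitute_ring_hom f])
qed

definition toric_ideal :: "nat \<Rightarrow> (nat, 'a::field) mpoly \<Rightarrow> nat \<Rightarrow> (nat list, 'a) mpoly set" where
  "toric_ideal k f n = a_kernel (poly_ring (tuples k n)) (poly_ring {1..n}) (toric_map f)"

section \<open>Laurent ideals\<close>

definition to_laurent :: "('v, 'a::field) mpoly \<Rightarrow> ('v, 'a) lpoly" where
  "to_laurent p =
     (\<Sum>m\<in>Poly_Mapping.keys p. Poly_Mapping.single (Poly_Mapping.map int m) (Poly_Mapping.lookup p m))"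

text \<open>The set of all \<open>g h\<^sup>-\<^sup>1\<close> with \<open>g \<in> I\<close> and \<open>h\<close> a monomial; \<open>m\<close> is the exponent vector of \<open>h\<close>.\<close>
definition laurent_ideal :: "'v set \<Rightarrow> ('v, 'a::field) mpoly set \<Rightarrow> ('v, 'a) lpoly set" where
  "laurent_ideal V I =
     {to_laurent g * Poly_Mapping.single (- Poly_Mapping.map int m) 1 | g m.
        g \<in> I \<and> Poly_Mapping.keys m \<subseteq> V}"

section \<open>Invariant chains\<close>

definition perm_act :: "(nat \<Rightarrow> nat) \<Rightarrow> (nat list, 'a::field) lpoly \<Rightarrow> (nat list, 'a) lpoly" where
  "perm_act \<sigma> p =
     (\<Sum>m\<in>Poly_Mapping.keys p.
        Poly_Mapping.single
          (\<Sum>u\<in>Poly_Mapping.keys m. Poly_Mapping.single (map \<sigma> u) (Poly_Mapping.lookup m u))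
          (Poly_Mapping.lookup p m))"

definition sym_orbit :: "nat \<Rightarrow> (nat list, 'a::field) lpoly set \<Rightarrow> (nat list, 'a) lpoly set" where
  "sym_orbit m J = {perm_act \<sigma> g | \<sigma> g. \<sigma> permutes {1..m} \<and> g \<in> J}"

definition invariant_chain :: "nat \<Rightarrow> (nat \<Rightarrow> (nat list, 'a::field) lpoly set) \<Rightarrow> bool" where
  "invariant_chain k J \<longleftrightarrow>
     (\<forall>n\<ge>k. ideal (J n) (laurent_ring (tuples k n)) \<and> J n \<subseteq> J (Suc n)) \<and>
     (\<forall>n\<ge>k. \<forall>m\<ge>n. sym_orbit m (J n) \<subseteq> J m)"

definition stabilization_bound :: "nat \<Rightarrow> (nat \<Rightarrow> (nat list, 'a::field) lpoly set) \<Rightarrow> nat \<Rightarrow> bool" where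
  "stabilization_bound k J N \<longleftrightarrow>
     k \<le> N \<and> (\<forall>m\<ge>N. Idl\<^bsub>laurent_ring (tuples k m)\<^esub> (sym_orbit m (J N)) = J m)"

text \<open>Generators for the chain are generators of \<open>J N\<close>, where \<open>N\<close> is a stabilization bound.\<close>
definition chain_generators ::
  "nat \<Rightarrow> (nat \<Rightarrow> (nat list, 'a::field) lpoly set) \<Rightarrow> nat \<Rightarrow> (nat list, 'a) lpoly set \<Rightarrow> bool" where
  "chain_generators k J N G \<longleftrightarrow>
     stabilization_bound k J N \<and>
     G \<subseteq> carrier (laurent_ring (tuples k N)) \<and>
     Idl\<^bsub>laurent_ring (tuples k N)\<^esub> G = J N"

section \<open>Algorithms\<close>

text \<open>
  Programs for the partial recursive functions, in the unary presentation: several arguments are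
  passed through the Cantor pairing \<^const>\<open>prod_encode\<close>.  \<open>run P x y\<close> means that \<open>P\<close> halts on
  input \<open>x\<close> with output \<open>y\<close>.
\<close>

datatype prog =
    PZero
  | PSucc
  | PFst
  | PSnd
  | PPair prog prog
  | PComp prog prog
  | PRec prog prog
  | PMin prog

inductive run :: "prog \<Rightarrow> nat \<Rightarrow> nat \<Rightarrow> bool" where
  run_zero: "run PZero x 0"
| run_succ: "run PSucc x (Suc x)"
| run_fst: "run PFst (prod_encode (a, b)) a"
| run_snd: "run PSnd (prod_encode (a, b)) b"
| run_pair: "run P x a \<Longrightarrow> run Q x b \<Longrightarrow> run (PPair P Q) x (prod_encode (a, b))"
| run_comp: "run Q x y \<Longrightarrow> run P y z \<Longrightarrow> run (PComp P Q) x z"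
| run_rec_0: "run P a y \<Longrightarrow> run (PRec P Q) (prod_encode (a, 0)) y"
| run_rec_Suc: "run (PRec P Q) (prod_encode (a, n)) y \<Longrightarrow>
    run Q (prod_encode (a, prod_encode (n, y))) z \<Longrightarrow>
    run (PRec P Q) (prod_encode (a, Suc n)) z"
| run_min: "run P (prod_encode (a, n)) 0 \<Longrightarrow>
    (\<forall>i<n. \<exists>y. run P (prod_encode (a, i)) (Suc y)) \<Longrightarrow>
    run (PMin P) a n"

lemma run_deterministic: "run P x y \<Longrightarrow> run P x z \<Longrightarrow> y = z"
proof (induction arbitrary: z rule: run.induct)
  case (run_rec_0 P a y Q)
  from run_rec_0.prems show ?case
    by (cases rule: run.cases) (use run_rec_0.IH in \<open>auto dest!: injD[OF inj_prod_encode]\<close>)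
next
  case (run_rec_Suc P Q a n y w)
  from run_rec_Suc.prems show ?case
    by (cases rule: run.cases) (use run_rec_Suc.IH in \<open>auto dest!: injD[OF inj_prod_encode]\<close>)
next
  case (run_min P a n)
  from run_min.prems obtain "run P (prod_encode (a, z)) 0"
    and "\<forall>i<z. \<exists>y. run P (prod_encode (a, i)) (Suc y)"
    by (cases rule: run.cases) auto
  then show ?case
    using run_min.IH by (metis linorder_neqE_nat nat.distinct(1))
next
  case (run_comp Q x y P z w)
  from run_comp.prems show ?case
    by (cases rule: run.cases) (use run_comp.IH in auto)
next
  case (run_pair P x a Q b)
  from run_pair.prems show ?case
    by (cases rule: run.cases) (use run_pair.IH in auto)
qed (auto elim: run.cases dest!: injD[OF inj_prod_encode])

section \<open>Finite descriptions of Laurent polynomials\<close>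

text \<open>
  The field is arbitrary, so its elements have no finite descriptions in general.  An algorithm
  therefore writes down Laurent polynomials with integer coefficients, as lists of terms
  \<open>(c, [(u, e), \<dots>])\<close> standing for \<open>c x\<^sub>u\<^sup>e \<dots>\<close>, and these are read over the field through
  the canonical map \<^const>\<open>of_int\<close>.
\<close>

type_synonym lpoly_term = "int \<times> (nat list \<times> int) list"

definition lpoly_of_terms :: "lpoly_term list \<Rightarrow> (nat list, 'a::field) lpoly" where
  "lpoly_of_terms ts =
     (\<Sum>(c, m)\<leftarrow>ts. Poly_Mapping.single (\<Sum>(u, e)\<leftarrow>m. Poly_Mapping.single u e) (of_int c))"

definition encode_term :: "lpoly_term \<Rightarrow> nat" where
  "encode_term = (\<lambda>(c, m).
     prod_encode (int_encode c,
       list_encode (map (\<lambda>(u, e). prod_encode (list_encode u, int_encode e)) m)))"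

definition encode_output :: "nat \<Rightarrow> lpoly_term list list \<Rightarrow> nat" where
  "encode_output N gs =
     prod_encode (N, list_encode (map (\<lambda>ts. list_encode (map encode_term ts)) gs))"

end

theory Submission
  imports Defs
begin

text \<open>
  A Laurent monomial map sends \<open>x\<^sup>a\<close> to \<open>t\<^bsup>w(a)\<^esup>\<close> for an additive map \<open>w\<close> of exponent
  lattices, and its kernel is generated by the \<open>x\<^sup>a - 1\<close> with \<open>w(a) = 0\<close>.  So each Laurent ideal
  of the chain is described by a lattice, and generators of the lattice give generators of the
  ideal.  It remains to find generators of the lattice that use few labels and have a bounded size.

  Let \<open>d\<close> be the degree of \<open>f = y\<^sup>\<alpha>\<close>.  Modulo the binomials of degree at most \<open>2 d + 2\<close> in the ideal,
  replacing the label \<open>b\<close> by \<open>a\<close> at position \<open>i\<close> of a tuple changes the tuple variable by a factor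
  \<open>D\<^sub>i(a,b)\<close> that depends only on \<open>i\<close>, \<open>a\<close>, \<open>b\<close>: this is the quadratic binomial
  \<open>x\<^bsub>u[i:=a]\<^esub> x\<^bsub>w[i:=b]\<^esub> - x\<^bsub>u[i:=b]\<^esub> x\<^bsub>w[i:=a]\<^esub>\<close>.  Hence, writing additively, every exponent
  vector becomes a multiple of one fixed tuple plus a combination of the \<open>D\<^sub>i(y,1)\<close>.  If its weight is
  zero and \<open>d > 0\<close>, the multiple is zero and for each label \<open>y\<close> the coefficients of the \<open>D\<^sub>i(y,1)\<close>
  form a syzygy of \<open>(\<alpha>\<^sub>1, \<dots>, \<alpha>\<^sub>k)\<close>.  With \<open>g\<close> the greatest common divisor of the \<open>\<alpha>\<^sub>i\<close>, the entries
  \<open>\<alpha>\<^sub>i / g\<close> generate the unit ideal of the integers, so all their syzygies are combinations of the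
  Koszul syzygies \<open>(\<alpha>\<^sub>j / g) D\<^sub>i - (\<alpha>\<^sub>i / g) D\<^sub>j\<close>, which again come from binomials of degree
  at most \<open>2 d\<close>.  If \<open>d = 0\<close>, all \<open>x\<^sub>u - 1\<close> are in the ideal.  This argument is
  \<open>weight_kernel_mem\<close>, and \<open>toric_kernel_generated_by_binomials\<close> is its consequence for ideals.

  All these binomials involve at most \<open>2 k\<close> labels, so a permutation moves them into \<open>[4 k]\<close>:
  \<open>4 k\<close> is a stabilization bound, \<open>stabilization_bound_toric_kernel\<close>.  (The argument needs room
  for a tuple that avoids two given ones, or three given labels, which \<open>4 k\<close> labels provide.)  Taking
  \<^emph>\<open>all\<close> balanced binomials of degree at most \<open>2 d + 2\<close> as generators makes the algorithm a bounded
  search: run through all codes below an explicit bound, and keep those that describe a binomial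
  whose two sides have the same image.  That this is done by a program is shown with closure
  properties of computable functions, ending in \<open>computable_generator_list\<close>.
\<close>

section \<open>Push-forward of formal sums\<close>

text \<open>
  The linear extension of a map of basis elements.  Every map between (Laurent) polynomial rings
  in this development that sends monomials to monomials is of this form: the inclusion of
  polynomials into Laurent polynomials, the action of permutations, and the toric maps.  Their
  compatibilities are then instances of \<open>push_push\<close>.
\<close>
definition push :: "('b \<Rightarrow> 'c) \<Rightarrow> ('b \<Rightarrow>\<^sub>0 'a::comm_monoid_add) \<Rightarrow> ('c \<Rightarrow>\<^sub>0 'a)" where
  "push h p = (\<Sum>m\<in>Poly_Mapping.keys p. Poly_Mapping.single (h m) (Poly_Mapping.lookup p m))"

lemma push_superset:
  "push h p = (\<Sum>m\<in>A. Poly_Mapping.single (h m) (Poly_Mapping.lookup p m))"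
  if "finite A" "Poly_Mapping.keys p \<subseteq> A"
  unfolding push_def using that by (intro sum.mono_neutral_left) (auto simp: in_keys_iff)

lemma push_0 [simp]: "push h 0 = 0"
  by (simp add: push_def)

lemma push_single [simp]: "push h (Poly_Mapping.single m c) = Poly_Mapping.single (h m) c"
  using push_superset[of "{m}" "Poly_Mapping.single m c" h] by simp

lemma push_add: "push h (p + q) = push h p + push h q"
proof -
  let ?A = "Poly_Mapping.keys p \<union> Poly_Mapping.keys q"
  show ?thesis
    using push_superset[of ?A p h] push_superset[of ?A q h] push_superset[of ?A "p + q" h]
      Poly_Mapping.keys_add[of p q]
    by (simp add: lookup_add single_add sum.distrib)
qed

lemma push_diff: "push h (p - q) = push h p - push h q"
  for p q :: "'b \<Rightarrow>\<^sub>0 'a::ab_group_add"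
  using push_add[of h "p - q" q] by simp

lemma push_push: "push g (push h p) = push (\<lambda>m. g (h m)) p"
  by (induction p rule: poly_mapping_add_induct) (simp_all add: push_add)

lemma push_cong: "push g p = push h p" if "\<And>m. m \<in> Poly_Mapping.keys p \<Longrightarrow> g m = h m"
  unfolding push_def using that by (intro sum.cong) auto

lemma push_ident: "push (\<lambda>m. m) p = p"
  by (induction p rule: poly_mapping_add_induct) (simp_all add: push_add)

lemma keys_push: "Poly_Mapping.keys (push h p) \<subseteq> h ` Poly_Mapping.keys p"
proof
  fix x assume "x \<in> Poly_Mapping.keys (push h p)"
  then have "(\<Sum>m\<in>Poly_Mapping.keys p. (Poly_Mapping.lookup p m when h m = x)) \<noteq> 0"
    by (simp add: in_keys_iff push_def lookup_sum lookup_single)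
  then obtain m where "m \<in> Poly_Mapping.keys p" "(Poly_Mapping.lookup p m when h m = x) \<noteq> 0"
    by (meson sum.neutral)
  then show "x \<in> h ` Poly_Mapping.keys p"
    by auto
qed

text \<open>
  On monoid rings, the linear extension of a homomorphism of monoids is multiplicative.
\<close>
lemma push_mult:
  fixes p q :: "'b::monoid_add \<Rightarrow>\<^sub>0 'a::comm_ring_1" and h :: "'b \<Rightarrow> 'c::monoid_add"
  assumes "\<And>a b. h (a + b) = h a + h b"
  shows "push h (p * q) = push h p * push h q"
proof (induction p rule: poly_mapping_add_induct)
  case (single m c)
  show ?case
    by (induction q rule: poly_mapping_add_induct)
      (simp_all add: push_add mult_single assms distrib_left)
qed (simp_all add: push_add distrib_right)

lemma push_translate:
  fixes p :: "'b::monoid_add \<Rightarrow>\<^sub>0 'a::comm_ring_1"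
  shows "push (\<lambda>m. m + a) p = p * Poly_Mapping.single a 1"
  by (induction p rule: poly_mapping_add_induct) (simp_all add: push_add mult_single distrib_right)

section \<open>The Laurent ideals as kernels\<close>

lemma carrier_laurent_ring:
  "p \<in> carrier (laurent_ring V) \<longleftrightarrow> (\<forall>m\<in>Poly_Mapping.keys p. Poly_Mapping.keys m \<subseteq> V)"
  by (simp add: laurent_ring_def ring_in_vars_def)

lemma carrier_poly_ring:
  "p \<in> carrier (poly_ring V) \<longleftrightarrow> (\<forall>m\<in>Poly_Mapping.keys p. Poly_Mapping.keys m \<subseteq> V)"
  by (simp add: poly_ring_def ring_in_vars_def)

lemma laurent_ring_ops:
  "(\<oplus>\<^bsub>laurent_ring V\<^esub>) = (+)" "(\<otimes>\<^bsub>laurent_ring V\<^esub>) = (*)"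
  "\<zero>\<^bsub>laurent_ring V\<^esub> = 0" "\<one>\<^bsub>laurent_ring V\<^esub> = 1"
  by (simp_all add: laurent_ring_def ring_in_vars_def)

lemma cring_laurent_ring: "cring (laurent_ring V)"
  unfolding laurent_ring_def by (rule cring_ring_in_vars)

lemma a_inv_laurent_ring: "\<ominus>\<^bsub>laurent_ring V\<^esub> p = - p" if "p \<in> carrier (laurent_ring V)"
proof -
  interpret cring "laurent_ring V" by (rule cring_laurent_ring)
  have "- p \<in> carrier (laurent_ring V)"
    using that by (simp add: carrier_laurent_ring)
  then show ?thesis
    using minus_equality[of "- p" p] that by (simp add: laurent_ring_ops)
qed

text \<open>
  The exponent vector of the image of the monomial \<open>x\<^sup>m\<close> under the toric map of \<open>y\<^sup>\<alpha>\<close>.  The type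
  of exponents is left open, since both natural exponents (for polynomials) and integer exponents
  (for Laurent polynomials) are needed.
\<close>
definition weight ::
  "nat list \<Rightarrow> (nat list \<Rightarrow>\<^sub>0 'e::comm_semiring_1) \<Rightarrow> (nat \<Rightarrow>\<^sub>0 'e)" where
  "weight \<alpha> m = (\<Sum>u\<in>Poly_Mapping.keys m. \<Sum>i<length \<alpha>.
     Poly_Mapping.single (u ! i) (Poly_Mapping.lookup m u * of_nat (\<alpha> ! i)))"

lemma weight_superset:
  "weight \<alpha> m = (\<Sum>u\<in>A. \<Sum>i<length \<alpha>.
     Poly_Mapping.single (u ! i) (Poly_Mapping.lookup m u * of_nat (\<alpha> ! i)))"
  if "finite A" "Poly_Mapping.keys m \<subseteq> A"
  unfolding weight_def using that by (intro sum.mono_neutral_left) (auto simp: in_keys_iff)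

lemma weight_0 [simp]: "weight \<alpha> 0 = 0"
  by (simp add: weight_def)

lemma weight_single:
  "weight \<alpha> (Poly_Mapping.single u c) =
     (\<Sum>i<length \<alpha>. Poly_Mapping.single (u ! i) (c * of_nat (\<alpha> ! i)))"
  using weight_superset[of "{u}" "Poly_Mapping.single u c" \<alpha>] by simp

lemma weight_add: "weight \<alpha> (a + b) = weight \<alpha> a + weight \<alpha> b"
proof -
  let ?A = "Poly_Mapping.keys a \<union> Poly_Mapping.keys b"
  show ?thesis
    using weight_superset[of ?A a \<alpha>] weight_superset[of ?A b \<alpha>] weight_superset[of ?A "a + b" \<alpha>]
      Poly_Mapping.keys_add[of a b]
    by (simp add: lookup_add distrib_right single_add sum.distrib)
qed

lemma weight_diff: "weight \<alpha> (a - b) = weight \<alpha> a - weight \<alpha> b"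
  for a b :: "nat list \<Rightarrow>\<^sub>0 int"
  using weight_add[of \<alpha> "a - b" b] by simp

lemma lookup_map: "Poly_Mapping.lookup (Poly_Mapping.map h m) x = h (Poly_Mapping.lookup m x)"
  if "h 0 = 0"
  using that by (simp add: map.rep_eq when_def)

lemma lookup_map_int [simp]:
  "Poly_Mapping.lookup (Poly_Mapping.map int m) x = int (Poly_Mapping.lookup m x)"
  by (simp add: lookup_map)

lemma keys_map_int [simp]: "Poly_Mapping.keys (Poly_Mapping.map int m) = Poly_Mapping.keys m"
  by (auto simp: in_keys_iff)

lemma map_int_sum: "Poly_Mapping.map int (sum f A) = (\<Sum>x\<in>A. Poly_Mapping.map int (f x))"
  by (rule poly_mapping_eqI) (simp add: lookup_sum)

lemma weight_map_int: "weight \<alpha> (Poly_Mapping.map int m) = Poly_Mapping.map int (weight \<alpha> m)"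
  by (simp add: weight_def map_int_sum)

lemma to_laurent_eq_push: "to_laurent p = push (Poly_Mapping.map int) p"
  by (simp add: to_laurent_def push_def)

lemma to_laurent_0 [simp]: "to_laurent 0 = 0"
  by (simp add: to_laurent_def)

text \<open>
  Exponents can be read back from the integers, so nothing is lost in the Laurent ring.
\<close>
lemma to_laurent_eq_0D: "p = 0" if "to_laurent p = 0"
proof -
  have "Poly_Mapping.map nat (Poly_Mapping.map int m) = m" for m :: "'a \<Rightarrow>\<^sub>0 nat"
    by (rule poly_mapping_eqI) (simp add: lookup_map)
  then have "push (Poly_Mapping.map nat) (to_laurent p) = p"
    by (simp add: to_laurent_eq_push push_push push_ident)
  then show ?thesis
    using that by simp
qed

lemma single_power:
  "Poly_Mapping.single m (1::'a::comm_semiring_1) ^ n = Poly_Mapping.single (\<Sum>i<n. m) 1"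
  by (induction n) (simp_all add: mult_single add.commute del: sum_constant)

lemma prod_single:
  "(\<Prod>i\<in>A. Poly_Mapping.single (h i) (1::'a::comm_semiring_1)) = Poly_Mapping.single (\<Sum>i\<in>A. h i) 1"
  by (induction A rule: infinite_finite_induct) (simp_all add: mult_single)

lemma sum_single_const: "(\<Sum>j<n. Poly_Mapping.single x c) = Poly_Mapping.single x (of_nat n * c)"
  for c :: "'a::comm_semiring_1"
  by (induction n) (simp_all add: single_add[symmetric] distrib_right add.commute del: sum_constant)

text \<open>
  Substituting monomials into a monomial gives a monomial, with the exponents added up.
\<close>
lemma toric_map_eq_push:
  "toric_map (monomial_of \<alpha> :: (nat, 'a::field) mpoly) p = push (weight \<alpha>) p"
proof -
  have mono: "(monomial_of \<alpha> :: (nat, 'a) mpoly) =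
      Poly_Mapping.single (\<Sum>i<length \<alpha>. Poly_Mapping.single (Suc i) (\<alpha> ! i)) 1"
    by (simp add: monomial_of_def var_def single_power prod_single sum_single_const del: sum_constant)
  let ?m = "\<Sum>i<length \<alpha>. Poly_Mapping.single (Suc i) (\<alpha> ! i)"
  have lookup_m: "Poly_Mapping.lookup ?m (Suc i) = \<alpha> ! i" if "i < length \<alpha>" for i
    using that by (simp add: lookup_sum lookup_single when_def sum.delta)
  have keys_m: "Poly_Mapping.keys ?m \<subseteq> Suc ` {..<length \<alpha>}"
    by (rule order_trans[OF Poly_Mapping.keys_sum]) (auto split: if_splits)
  have u: "substitute (\<lambda>i. var (u ! (i - 1))) (monomial_of \<alpha> :: (nat, 'a) mpoly) =
      Poly_Mapping.single (\<Sum>i<length \<alpha>. Poly_Mapping.single (u ! i) (\<alpha> ! i)) 1" for u :: "nat list"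
  proof -
    have "(\<Prod>v\<in>Poly_Mapping.keys ?m. var (u ! (v - 1)) ^ Poly_Mapping.lookup ?m v) =
        (\<Prod>v\<in>Suc ` {..<length \<alpha>}. var (u ! (v - 1)) ^ Poly_Mapping.lookup ?m v :: (nat, 'a) mpoly)"
      by (rule prod.mono_neutral_left) (use keys_m in \<open>auto simp: in_keys_iff\<close>)
    also have "\<dots> = (\<Prod>i<length \<alpha>. var (u ! i) ^ (\<alpha> ! i))"
      by (subst prod.reindex) (auto simp: lookup_m intro!: prod.cong)
    finally show ?thesis
      by (simp add: mono substitute_def const_def var_def single_power prod_single sum_single_const
          del: sum_constant)
  qed
  have scale: "(\<Sum>j<n. \<Sum>i<length \<alpha>. Poly_Mapping.single (u ! i) (\<alpha> ! i)) =
      (\<Sum>i<length \<alpha>. Poly_Mapping.single (u ! i) (n * \<alpha> ! i))" for n and u :: "nat list"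
    by (subst sum.swap) (simp add: sum_single_const del: sum_constant)
  show ?thesis
    by (simp add: toric_map_def u[unfolded One_nat_def] substitute_def[of _ p] single_power
        prod_single scale push_def weight_def const_def mult_single del: sum_constant)
qed

text \<open>
  The kernel of the Laurent monomial map \<open>x\<^sup>a \<mapsto> t\<^bsup>weight \<alpha> a\<^esup>\<close>.  It turns out to be the Laurent
  ideal of the toric ideal, which replaces fractions by a condition that is easy to check.
\<close>
definition toric_kernel :: "nat list \<Rightarrow> nat \<Rightarrow> (nat list, 'a::field) lpoly set" where
  "toric_kernel \<alpha> n =
     {p \<in> carrier (laurent_ring (tuples (length \<alpha>) n)). push (weight \<alpha>) p = 0}"

lemma push_weight_mult: "push (weight \<alpha>) (p * q) = push (weight \<alpha>) p * push (weight \<alpha>) q"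
  for p q :: "(nat list \<Rightarrow>\<^sub>0 'e::comm_semiring_1) \<Rightarrow>\<^sub>0 'a::comm_ring_1"
  by (rule push_mult) (rule weight_add)

lemma push_weight_to_laurent: "push (weight \<alpha>) (to_laurent p) = to_laurent (push (weight \<alpha>) p)"
  by (simp add: to_laurent_eq_push push_push weight_map_int)

lemma ideal_toric_kernel: "ideal (toric_kernel \<alpha> n) (laurent_ring (tuples (length \<alpha>) n))"
proof -
  let ?R = "laurent_ring (tuples (length \<alpha>) n) :: (nat list, 'a) lpoly ring"
  interpret cring ?R by (rule cring_laurent_ring)
  show ?thesis
  proof (rule idealI)
    show "ring ?R" ..
    show "subgroup (toric_kernel \<alpha> n) (add_monoid ?R)"
    proof (rule add.subgroupI)
      show "toric_kernel \<alpha> n \<subseteq> carrier ?R"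
        by (auto simp: toric_kernel_def)
      have "0 \<in> toric_kernel \<alpha> n"
        by (simp add: toric_kernel_def carrier_laurent_ring)
      then show "toric_kernel \<alpha> n \<noteq> {}"
        by blast
      show "\<ominus>\<^bsub>?R\<^esub> a \<in> toric_kernel \<alpha> n" if "a \<in> toric_kernel \<alpha> n" for a
        using that push_diff[of "weight \<alpha>" 0 a] a_inv_laurent_ring[of a]
        by (auto simp: toric_kernel_def carrier_laurent_ring)
      show "a \<oplus>\<^bsub>?R\<^esub> b \<in> toric_kernel \<alpha> n" if "a \<in> toric_kernel \<alpha> n" "b \<in> toric_kernel \<alpha> n" for a b
        using that add.m_closed[of a b]
        by (simp add: toric_kernel_def laurent_ring_ops push_add)
    qed
    show "x \<otimes>\<^bsub>?R\<^esub> a \<in> toric_kernel \<alpha> n" "a \<otimes>\<^bsub>?R\<^esub> x \<in> toric_kernel \<alpha> n"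
      if "a \<in> toric_kernel \<alpha> n" "x \<in> carrier ?R" for a x
      using that m_closed[of x a] m_closed[of a x]
      by (simp_all add: toric_kernel_def laurent_ring_ops push_weight_mult)
  qed
qed

text \<open>
  Monomials map to monomials, which are units, so multiplying by a monomial does not affect
  membership in the kernel.  A Laurent polynomial becomes a polynomial after multiplication by a
  monomial, and there the two kernels agree.
\<close>
lemma laurent_ideal_toric_ideal:
  "laurent_ideal (tuples (length \<alpha>) n) (toric_ideal (length \<alpha>) (monomial_of \<alpha>) n) =
     (toric_kernel \<alpha> n :: (nat list, 'a::field) lpoly set)"
proof (intro equalityI subsetI)
  let ?V = "tuples (length \<alpha>) n"
  have I: "g \<in> toric_ideal (length \<alpha>) (monomial_of \<alpha>) n \<longleftrightarrow>
      g \<in> carrier (poly_ring ?V) \<and> push (weight \<alpha>) g = 0" for g :: "(nat list, 'a) mpoly"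
    by (auto simp: toric_ideal_def a_kernel_def' toric_map_eq_push poly_ring_def ring_in_vars_def)
  {
    fix p :: "(nat list, 'a) lpoly"
    assume "p \<in> laurent_ideal ?V (toric_ideal (length \<alpha>) (monomial_of \<alpha>) n)"
    then obtain g m where p: "p = to_laurent g * Poly_Mapping.single (- Poly_Mapping.map int m) 1"
      and g: "g \<in> carrier (poly_ring ?V)" "push (weight \<alpha>) g = 0"
      and m: "Poly_Mapping.keys m \<subseteq> ?V"
      unfolding laurent_ideal_def I by blast
    interpret cring "laurent_ring ?V :: (nat list, 'a) lpoly ring" by (rule cring_laurent_ring)
    have "to_laurent g \<in> carrier (laurent_ring ?V)"
      using g(1) keys_push[of "Poly_Mapping.map int" g]
      by (fastforce simp: carrier_laurent_ring carrier_poly_ring to_laurent_eq_push)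
    moreover have "Poly_Mapping.single (- Poly_Mapping.map int m) (1::'a) \<in> carrier (laurent_ring ?V)"
      using m by (simp add: carrier_laurent_ring)
    ultimately have "p \<in> carrier (laurent_ring ?V)"
      using m_closed unfolding p laurent_ring_ops by blast
    moreover have "push (weight \<alpha>) (to_laurent g) = 0"
      using g(2) by (simp add: push_weight_to_laurent)
    ultimately show "p \<in> toric_kernel \<alpha> n"
      by (simp add: toric_kernel_def p push_weight_mult)
  next
    fix p :: "(nat list, 'a) lpoly"
    assume "p \<in> toric_kernel \<alpha> n"
    then have p0: "push (weight \<alpha>) p = 0"
      and "\<forall>a\<in>Poly_Mapping.keys p. Poly_Mapping.keys a \<subseteq> ?V"
      by (simp_all add: toric_kernel_def carrier_laurent_ring)
    then have pV: "Poly_Mapping.keys a \<subseteq> ?V" if "a \<in> Poly_Mapping.keys p" for a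
      using that by blast
    \<comment> \<open>a common denominator: the absolute values of all exponents that occur\<close>
    define m where "m = (\<Sum>a\<in>Poly_Mapping.keys p. Poly_Mapping.map (\<lambda>e. nat \<bar>e\<bar>) a)"
    have lookup_m: "Poly_Mapping.lookup m u = (\<Sum>a\<in>Poly_Mapping.keys p. nat \<bar>Poly_Mapping.lookup a u\<bar>)" for u
      unfolding m_def lookup_sum by (subst lookup_map) simp_all
    have m: "Poly_Mapping.keys m \<subseteq> ?V"
    proof
      fix u assume "u \<in> Poly_Mapping.keys m"
      then obtain a where "a \<in> Poly_Mapping.keys p" "nat \<bar>Poly_Mapping.lookup a u\<bar> \<noteq> 0"
        using sum.not_neutral_contains_not_neutral[of "\<lambda>a. nat \<bar>Poly_Mapping.lookup a u\<bar>"]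
        by (auto simp: in_keys_iff[of u m] lookup_m)
      then show "u \<in> ?V"
        using pV[of a] by (auto simp: in_keys_iff)
    qed
    have nonneg: "0 \<le> Poly_Mapping.lookup a u + int (Poly_Mapping.lookup m u)"
      if "a \<in> Poly_Mapping.keys p" for a u
    proof -
      have "nat \<bar>Poly_Mapping.lookup a u\<bar> \<le> Poly_Mapping.lookup m u"
        unfolding lookup_m using that by (intro member_le_sum) auto
      then show ?thesis
        by linarith
    qed
    define clear where "clear a = Poly_Mapping.map nat (a + Poly_Mapping.map int m)" for a
    define g where "g = push clear p"
    have clear: "Poly_Mapping.map int (clear a) = a + Poly_Mapping.map int m"
      if "a \<in> Poly_Mapping.keys p" for a
      by (rule poly_mapping_eqI)
        (use nonneg[OF that] in \<open>simp add: clear_def lookup_map lookup_add\<close>)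
    have "to_laurent g = push (\<lambda>a. a + Poly_Mapping.map int m) p"
      unfolding g_def to_laurent_eq_push push_push by (rule push_cong) (rule clear)
    then have g: "to_laurent g = p * Poly_Mapping.single (Poly_Mapping.map int m) 1"
      by (simp add: push_translate)
    have "Poly_Mapping.keys (clear a) \<subseteq> ?V" if "a \<in> Poly_Mapping.keys p" for a
      using clear[OF that] pV[OF that] m Poly_Mapping.keys_add[of a "Poly_Mapping.map int m"]
      by (metis Un_least keys_map_int order_trans)
    then have "g \<in> carrier (poly_ring ?V)"
      using keys_push[of clear p] unfolding carrier_poly_ring g_def by blast
    moreover have "to_laurent (push (weight \<alpha>) g) = 0"
      by (simp add: push_weight_to_laurent[symmetric] g push_weight_mult p0)
    ultimately have "g \<in> toric_ideal (length \<alpha>) (monomial_of \<alpha>) n"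
      unfolding I by (simp add: to_laurent_eq_0D)
    moreover have "p = to_laurent g * Poly_Mapping.single (- Poly_Mapping.map int m) 1"
      by (simp add: g mult.assoc mult_single)
    ultimately show "p \<in> laurent_ideal ?V (toric_ideal (length \<alpha>) (monomial_of \<alpha>) n)"
      unfolding laurent_ideal_def using m by blast
  }
qed

section \<open>Permuting labels\<close>

lemma perm_act_eq_push: "perm_act \<sigma> p = push (push (map \<sigma>)) p"
  by (simp add: perm_act_def push_def)

lemma tuples_mono: "tuples k n \<subseteq> tuples k m" if "n \<le> m"
  using that by (auto simp: tuples_def)

lemma map_in_tuples: "map \<sigma> u \<in> tuples k m" if "u \<in> tuples k n" "inj \<sigma>" "\<sigma> ` set u \<subseteq> {1..m}"
  using that by (auto simp: tuples_def distinct_map inj_on_def)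

lemma toric_kernel_mono: "toric_kernel \<alpha> n \<subseteq> toric_kernel \<alpha> m" if "n \<le> m"
  using tuples_mono[OF that] by (auto simp: toric_kernel_def carrier_laurent_ring)

text \<open>
  Permuting labels commutes with the weight.  Tuples of the right length are needed because
  \<open>map \<sigma> u ! i\<close> is \<open>\<sigma> (u ! i)\<close> only inside the list.
\<close>
lemma weight_permute:
  "weight \<alpha> (push (map \<sigma>) m) = push \<sigma> (weight \<alpha> m)"
  if "\<And>u. u \<in> Poly_Mapping.keys m \<Longrightarrow> length u = length \<alpha>" for m :: "nat list \<Rightarrow>\<^sub>0 int"
proof -
  have sum: "push h (sum f A) = (\<Sum>x\<in>A. push h (f x))"
    for h :: "'b \<Rightarrow> 'c" and f :: "'d \<Rightarrow> 'b \<Rightarrow>\<^sub>0 int" and A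
    by (induction A rule: infinite_finite_induct) (simp_all add: push_add)
  have "weight \<alpha> (push (map \<sigma>) m) =
      (\<Sum>u\<in>Poly_Mapping.keys m. weight \<alpha> (Poly_Mapping.single (map \<sigma> u) (Poly_Mapping.lookup m u)))"
  proof -
    have "weight \<alpha> (sum f A) = (\<Sum>x\<in>A. weight \<alpha> (f x))" for f :: "nat list \<Rightarrow> _ \<Rightarrow>\<^sub>0 int" and A
      by (induction A rule: infinite_finite_induct) (simp_all add: weight_add)
    then show ?thesis
      by (simp add: push_def)
  qed
  also have "\<dots> = push \<sigma> (weight \<alpha> m)"
    unfolding weight_def[of _ m] sum
    by (intro sum.cong refl) (simp add: weight_single that)
  finally show ?thesis .
qed

text \<open>
  The target level \<open>N\<close> may be smaller than \<open>n\<close>, as long as \<open>\<sigma>\<close> moves the labels that occur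
  in \<open>p\<close> into \<open>[N]\<close>.  This is how elements of a high level are recognised as permuted elements of
  a low one.
\<close>
lemma perm_act_toric_kernel:
  fixes p :: "(nat list, 'a::field) lpoly"
  assumes p: "p \<in> toric_kernel \<alpha> n" and \<sigma>: "inj \<sigma>"
    and Y: "\<And>m u. m \<in> Poly_Mapping.keys p \<Longrightarrow> u \<in> Poly_Mapping.keys m \<Longrightarrow> \<sigma> ` set u \<subseteq> {1..N}"
  shows "perm_act \<sigma> p \<in> toric_kernel \<alpha> N"
proof -
  have pV: "Poly_Mapping.keys m \<subseteq> tuples (length \<alpha>) n" if "m \<in> Poly_Mapping.keys p" for m
    using p that by (auto simp: toric_kernel_def carrier_laurent_ring)
  have "Poly_Mapping.keys (push (map \<sigma>) m) \<subseteq> tuples (length \<alpha>) N" if "m \<in> Poly_Mapping.keys p" for m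
    using keys_push[of "map \<sigma>" m] map_in_tuples[OF _ \<sigma>] pV[OF that] Y[OF that] by blast
  then have "perm_act \<sigma> p \<in> carrier (laurent_ring (tuples (length \<alpha>) N))"
    using keys_push[of "push (map \<sigma>)" p] unfolding carrier_laurent_ring perm_act_eq_push by blast
  moreover have "push (weight \<alpha>) (perm_act \<sigma> p) = push (\<lambda>m. push \<sigma> (weight \<alpha> m)) p"
    unfolding perm_act_eq_push push_push
    by (intro push_cong weight_permute) (use pV in \<open>auto simp: tuples_def\<close>)
  moreover have "\<dots> = push (push \<sigma>) (push (weight \<alpha>) p)"
    by (simp add: push_push)
  ultimately show ?thesis
    using p by (simp add: toric_kernel_def)
qed

lemma sym_orbit_toric_kernel: "sym_orbit m (toric_kernel \<alpha> n) \<subseteq> toric_kernel \<alpha> m" if "n \<le> m"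
proof
  fix p assume "p \<in> sym_orbit m (toric_kernel \<alpha> n :: (nat list, 'a) lpoly set)"
  then obtain \<sigma> g where p: "p = perm_act \<sigma> g" "\<sigma> permutes {1..m}"
    and g: "g \<in> (toric_kernel \<alpha> n :: (nat list, 'a) lpoly set)"
    unfolding sym_orbit_def by blast
  have "\<sigma> ` set u \<subseteq> {1..m}" if "a \<in> Poly_Mapping.keys g" "u \<in> Poly_Mapping.keys a" for a u
  proof -
    have "set u \<subseteq> {1..n}"
      using g that by (fastforce simp: toric_kernel_def carrier_laurent_ring tuples_def)
    then show ?thesis
      using permutes_in_image[OF p(2)] that \<open>n \<le> m\<close> by fastforce
  qed
  then show "p \<in> toric_kernel \<alpha> m"
    unfolding p(1) by (intro perm_act_toric_kernel[OF g permutes_inj[OF p(2)]])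
qed

lemma invariant_chain_toric_kernel: "invariant_chain (length \<alpha>) (toric_kernel \<alpha>)"
  unfolding invariant_chain_def
  by (simp add: ideal_toric_kernel toric_kernel_mono sym_orbit_toric_kernel)

lemma ex_permutes_into_initial_segment:
  assumes "Y \<subseteq> {1..m}" "card Y \<le> N" "N \<le> m"
  obtains \<sigma> where "\<sigma> permutes {1..m::nat}" "\<sigma> ` Y \<subseteq> {1..N}"
proof -
  let ?Z = "{1..card Y}"
  have fin: "finite Y"
    using assms(1) finite_subset by blast
  have le: "card Y \<le> m"
    using assms by simp
  obtain f where f: "bij_betw f Y ?Z"
    using finite_same_card_bij[OF fin, of ?Z] by auto
  have "card ({1..m} - Y) = card ({1..m} - ?Z)"
    using assms(1) fin le by (simp add: card_Diff_subset)
  then obtain g where g: "bij_betw g ({1..m} - Y) ({1..m} - ?Z)"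
    using finite_same_card_bij[of "{1..m} - Y" "{1..m} - ?Z"] by auto
  define \<sigma> where "\<sigma> x = (if x \<in> Y then f x else if x \<in> {1..m} then g x else x)" for x
  have "bij_betw \<sigma> Y ?Z"
    using f by (rule bij_betw_cong[THEN iffD1, rotated]) (simp add: \<sigma>_def)
  moreover have "bij_betw \<sigma> ({1..m} - Y) ({1..m} - ?Z)"
    using g by (rule bij_betw_cong[THEN iffD1, rotated]) (simp add: \<sigma>_def)
  ultimately have "bij_betw \<sigma> (Y \<union> ({1..m} - Y)) (?Z \<union> ({1..m} - ?Z))"
    by (rule bij_betw_combine) auto
  moreover have "Y \<union> ({1..m} - Y) = {1..m}" "?Z \<union> ({1..m} - ?Z) = {1..m}"
    using assms(1) le by auto
  ultimately have "bij_betw \<sigma> {1..m} {1..m}"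
    by simp
  then have "\<sigma> permutes {1..m}"
    by (rule bij_imp_permutes) (use assms(1) in \<open>auto simp: \<sigma>_def\<close>)
  moreover have "\<sigma> ` Y \<subseteq> {1..N}"
    using \<open>bij_betw \<sigma> Y ?Z\<close> assms(2) by (auto simp: bij_betw_def)
  ultimately show ?thesis
    using that by blast
qed

text \<open>
  An element that involves few labels is moved down to level \<open>N\<close> by a permutation \<open>\<sigma>\<close>, and
  comes back under the inverse of \<open>\<sigma>\<close>.
\<close>
lemma toric_kernel_in_sym_orbit:
  fixes p :: "(nat list, 'a::field) lpoly"
  assumes p: "p \<in> toric_kernel \<alpha> m" and Y: "card Y \<le> N" "N \<le> m"
    and supp: "\<And>a u. a \<in> Poly_Mapping.keys p \<Longrightarrow> u \<in> Poly_Mapping.keys a \<Longrightarrow> set u \<subseteq> Y"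
    and "Y \<subseteq> {1..m}"
  shows "p \<in> sym_orbit m (toric_kernel \<alpha> N)"
proof -
  obtain \<sigma> where \<sigma>: "\<sigma> permutes {1..m}" "\<sigma> ` Y \<subseteq> {1..N}"
    using ex_permutes_into_initial_segment assms by metis
  have "perm_act \<sigma> p \<in> toric_kernel \<alpha> N"
    using \<sigma>(2) supp by (intro perm_act_toric_kernel[OF p permutes_inj[OF \<sigma>(1)]]) blast
  moreover have "p = perm_act (inv_into UNIV \<sigma>) (perm_act \<sigma> p)"
    by (simp add: perm_act_eq_push push_push push_ident permutes_inverses[OF \<sigma>(1)] comp_def)
  ultimately show ?thesis
    unfolding sym_orbit_def using permutes_inv[OF \<sigma>(1)] by blast
qed

section \<open>Generators of the exponent lattice\<close>

text \<open>
  The exponent vector of the product of the tuple variables in a list.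
\<close>
definition exps :: "nat list list \<Rightarrow> (nat list \<Rightarrow>\<^sub>0 int)" where
  "exps U = (\<Sum>u\<leftarrow>U. frag_of u)"

lemma exps_simps [simp]:
  "exps [] = 0" "exps (u # U) = frag_of u + exps U" "exps (U @ W) = exps U + exps W"
  by (simp_all add: exps_def)

lemma exps_replicate [simp]: "exps (replicate n u) = frag_cmul (int n) (frag_of u)"
  by (induction n) (simp_all add: frag_cmul_distrib)

lemma weight_frag_of:
  "weight \<alpha> (frag_of u) = (\<Sum>i<length \<alpha>. Poly_Mapping.single (u ! i) (int (\<alpha> ! i)))"
  by (simp add: weight_single)

lemma weight_frag_cmul: "weight \<alpha> (frag_cmul c a) = frag_cmul c (weight \<alpha> a)"
  by (rule poly_mapping_eqI)
    (simp add: weight_superset[OF finite_keys keys_cmul] weight_def[of _ a] lookup_sum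
      lookup_single sum_distrib_left mult_when mult.assoc)

lemma bezout_finite:
  fixes \<alpha> :: "'b \<Rightarrow> nat"
  assumes "finite A"
  shows "\<exists>s g. (\<Sum>i\<in>A. s i * int (\<alpha> i)) = int g \<and> (\<forall>i\<in>A. g dvd \<alpha> i)"
  using assms
proof (induction A rule: finite_induct)
  case empty
  show ?case
    by (rule exI[of _ "\<lambda>_. 0"], rule exI[of _ 0]) simp
next
  case (insert x A)
  then obtain s g where sg: "(\<Sum>i\<in>A. s i * int (\<alpha> i)) = int g" "\<forall>i\<in>A. g dvd \<alpha> i"
    by blast
  obtain a b where ab: "a * int (\<alpha> x) + b * int g = gcd (int (\<alpha> x)) (int g)"
    using bezout_int by blast
  define s' where "s' i = (if i = x then a else b * s i)" for i
  have "(\<Sum>i\<in>A. s' i * int (\<alpha> i)) = b * (\<Sum>i\<in>A. s i * int (\<alpha> i))"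
    unfolding sum_distrib_left by (rule sum.cong) (use insert.hyps(2) in \<open>auto simp: s'_def\<close>)
  then have "(\<Sum>i\<in>insert x A. s' i * int (\<alpha> i)) = int (gcd (\<alpha> x) g)"
    using insert.hyps ab by (simp add: sg(1) s'_def)
  moreover have "\<forall>i\<in>insert x A. gcd (\<alpha> x) g dvd \<alpha> i"
    using sg(2) by (auto intro: dvd_trans[OF gcd_dvd2])
  ultimately show ?case
    by blast
qed

lemma ex_tuple_avoiding:
  assumes "finite Y" "card Y + k \<le> m"
  obtains w where "w \<in> tuples k m" "set w \<inter> Y = {}"
proof -
  have "m - card Y \<le> card ({1..m} - Y)"
    using diff_card_le_card_Diff[OF assms(1), of "{1..m}"] by simp
  then obtain Z where "Z \<subseteq> {1..m} - Y" "card Z = k" "finite Z"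
    using assms(2) obtain_subset_with_card_n[of k "{1..m} - Y"] by (metis add_le_imp_le_diff
        add.commute finite_Diff finite_atLeastAtMost finite_subset le_trans)
  then show ?thesis
    using that finite_distinct_list[of Z] by (fastforce simp: tuples_def distinct_card)
qed

lemma tuples_nth: "u ! i \<in> {1..m}" if "u \<in> tuples k m" "i < k"
  using that nth_mem[of i u] unfolding tuples_def by blast

lemma tuples_list_update: "u[i := y] \<in> tuples k m"
  if "u \<in> tuples k m" "y \<in> {1..m}" "y \<notin> set u"
  using that set_update_subset_insert[of u i y] distinct_list_update[of u y i]
  by (auto simp: tuples_def)

text \<open>
  A subgroup \<open>S\<close> of exponent vectors that contains the difference of the two exponent vectors of each
  small binomial in the toric ideal.  The aim is that \<open>S\<close> contains every vector of weight zero; the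
  application has \<open>S = {a. x\<^sup>a - 1 \<in> I}\<close> for an ideal \<open>I\<close>.
\<close>
locale binomial_lattice =
  fixes \<alpha> :: "nat list" and m :: nat and S :: "(nat list \<Rightarrow>\<^sub>0 int) set"
  assumes zero_mem: "0 \<in> S"
    and diff_mem: "\<And>a b. a \<in> S \<Longrightarrow> b \<in> S \<Longrightarrow> a - b \<in> S"
    and binomial_mem: "\<And>U W. set U \<union> set W \<subseteq> tuples (length \<alpha>) m \<Longrightarrow>
      length U \<le> 2 * sum_list \<alpha> + 2 \<Longrightarrow> length W \<le> 2 * sum_list \<alpha> + 2 \<Longrightarrow>
      card (\<Union>(set ` (set U \<union> set W))) \<le> 2 * length \<alpha> \<Longrightarrow>
      weight \<alpha> (exps U) = weight \<alpha> (exps W) \<Longrightarrow> exps U - exps W \<in> S"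
    and size_m: "4 * length \<alpha> \<le> m" and pos: "1 \<le> length \<alpha>"
begin

abbreviation "V \<equiv> tuples (length \<alpha>) m"

lemma uminus_mem: "- a \<in> S" if "a \<in> S"
  using diff_mem[OF zero_mem that] by simp

lemma add_mem: "a + b \<in> S" if "a \<in> S" "b \<in> S"
  using diff_mem[OF that(1) uminus_mem[OF that(2)]] by simp

lemma cmul_mem: "frag_cmul c a \<in> S" if "a \<in> S"
  by (rule frag_closure_minus_cmul[where P = "\<lambda>a. a \<in> S"]) (use zero_mem diff_mem that in auto)

lemma sum_mem: "sum f A \<in> S" if "\<And>x. x \<in> A \<Longrightarrow> f x \<in> S"
  using that by (induction A rule: infinite_finite_induct) (simp_all add: zero_mem add_mem)

text \<open>
  The class of this vector modulo \<open>S\<close> is the \<open>D\<^sub>i(a,b)\<close> of the introduction.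
\<close>
definition exchange :: "nat \<Rightarrow> nat \<Rightarrow> nat \<Rightarrow> nat list \<Rightarrow> (nat list \<Rightarrow>\<^sub>0 int)" where
  "exchange i a b u = frag_of (u[i := a]) - frag_of (u[i := b])"

lemma weight_exchange:
  assumes "i < length \<alpha>" "length u = length \<alpha>"
  shows "weight \<alpha> (exchange i a b u) =
    Poly_Mapping.single a (int (\<alpha> ! i)) - Poly_Mapping.single b (int (\<alpha> ! i))"
proof -
  have "weight \<alpha> (exchange i a b u) = (\<Sum>l<length \<alpha>. if l = i then
      Poly_Mapping.single a (int (\<alpha> ! i)) - Poly_Mapping.single b (int (\<alpha> ! i)) else 0)"
    unfolding exchange_def weight_diff weight_frag_of sum_subtractf[symmetric]
    by (rule sum.cong) (use assms in auto)
  then show ?thesis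
    using assms by simp
qed

text \<open>
  The one family of binomials that the proof uses when \<open>d > 0\<close>: both exchanges have a weight
  proportional to \<open>t\<^sub>a / t\<^sub>b\<close>, with factors \<open>\<alpha>\<^sub>i\<close> and \<open>\<alpha>\<^sub>j\<close>, which \<open>p\<close> and \<open>q\<close> balance.  The case
  \<open>p = q = 1\<close>, \<open>i = j\<close> says that the exchange does not depend on the tuple; other \<open>p\<close>, \<open>q\<close> give the
  Koszul syzygies.  Besides \<open>a\<close> and \<open>b\<close> only the \<open>k - 1\<close> other labels of \<open>u\<close> and of \<open>w\<close> occur,
  hence the bound \<open>2 k\<close> on the number of labels.
\<close>
lemma exchange_relation:
  assumes u: "u[i := a] \<in> V" "u[i := b] \<in> V" and w: "w[j := a] \<in> V" "w[j := b] \<in> V"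
    and ij: "i < length \<alpha>" "j < length \<alpha>" and pq: "p * \<alpha> ! i = q * \<alpha> ! j"
    and deg: "p + q \<le> 2 * sum_list \<alpha> + 2"
  shows "frag_cmul (int p) (exchange i a b u) - frag_cmul (int q) (exchange j a b w) \<in> S"
proof -
  let ?U = "replicate p (u[i := a]) @ replicate q (w[j := b])"
  let ?W = "replicate p (u[i := b]) @ replicate q (w[j := a])"
  have len: "length u = length \<alpha>" "length w = length \<alpha>"
    using u w by (simp_all add: tuples_def)
  have diff: "exps ?U - exps ?W =
      frag_cmul (int p) (exchange i a b u) - frag_cmul (int q) (exchange j a b w)"
    by (rule poly_mapping_eqI)
      (simp add: exchange_def lookup_add lookup_minus algebra_simps)
  have "weight \<alpha> (exps ?U - exps ?W) = 0"
    unfolding diff weight_diff weight_frag_cmul weight_exchange[OF ij(1) len(1)]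
      weight_exchange[OF ij(2) len(2)]
    using pq by (intro poly_mapping_eqI)
      (simp add: lookup_minus lookup_single when_def flip: of_nat_mult)
  then have "weight \<alpha> (exps ?U) = weight \<alpha> (exps ?W)"
    by (simp add: weight_diff)
  moreover have "set ?U \<union> set ?W \<subseteq> V"
    using u w by (auto simp: set_replicate_conv_if)
  moreover have "card (\<Union>(set ` (set ?U \<union> set ?W))) \<le> 2 * length \<alpha>"
  proof -
    have others: "\<exists>X. finite X \<and> Suc (card X) \<le> length \<alpha> \<and> (\<forall>c. set (v[l := c]) \<subseteq> insert c X)"
      if "length v = length \<alpha>" "l < length \<alpha>" for v :: "nat list" and l
    proof (intro exI conjI allI)
      let ?X = "(\<lambda>i. v ! i) ` ({..<length \<alpha>} - {l})"
      show "finite ?X"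
        by simp
      have "card ?X \<le> card ({..<length \<alpha>} - {l})"
        by (rule card_image_le) simp
      then show "Suc (card ?X) \<le> length \<alpha>"
        using that by simp
      show "set (v[l := c]) \<subseteq> insert c ?X" for c
        using that by (auto simp: set_conv_nth nth_list_update)
    qed
    obtain X where X: "finite X" "Suc (card X) \<le> length \<alpha>" "\<And>c. set (u[i := c]) \<subseteq> insert c X"
      using others[OF len(1) ij(1)] by blast
    obtain Y where Y: "finite Y" "Suc (card Y) \<le> length \<alpha>" "\<And>c. set (w[j := c]) \<subseteq> insert c Y"
      using others[OF len(2) ij(2)] by blast
    have "\<Union>(set ` (set ?U \<union> set ?W)) \<subseteq> {a, b} \<union> (X \<union> Y)"
      using X(3)[of a] X(3)[of b] Y(3)[of a] Y(3)[of b] by (auto simp: set_replicate_conv_if)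
    then have "card (\<Union>(set ` (set ?U \<union> set ?W))) \<le> card ({a, b} \<union> (X \<union> Y))"
      using X(1) Y(1) by (intro card_mono) auto
    also have "\<dots> \<le> card {a, b} + (card X + card Y)"
      by (meson add_le_mono card_Un_le le_refl le_trans)
    also have "\<dots> \<le> 2 + (card X + card Y)"
      by (simp add: card_insert_if)
    finally show ?thesis
      using X(2) Y(2) by simp
  qed
  ultimately have "exps ?U - exps ?W \<in> S"
    using deg by (intro binomial_mem) auto
  then show ?thesis
    unfolding diff .
qed

lemma exchange_independent:
  assumes "u[i := a] \<in> V" "u[i := b] \<in> V" "w[i := a] \<in> V" "w[i := b] \<in> V" "i < length \<alpha>"
  shows "exchange i a b u - exchange i a b w \<in> S"
  using exchange_relation[of u i a b w i 1 1] assms by simp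

text \<open>
  Since exchanges are independent of the tuple modulo \<open>S\<close>, one can fix a tuple for each label;
  the label 1 serves as origin.
\<close>
definition wit :: "nat \<Rightarrow> nat list" where
  "wit y = (SOME w. w \<in> V \<and> set w \<inter> {y, 1} = {})"

definition \<delta> :: "nat \<Rightarrow> nat \<Rightarrow> (nat list \<Rightarrow>\<^sub>0 int)" where
  "\<delta> i y = exchange i y 1 (wit y)"

lemma wit: "wit y \<in> V" "y \<notin> set (wit y)" "1 \<notin> set (wit y)"
proof -
  have "card {y, 1} + length \<alpha> \<le> m"
    using size_m pos by (simp add: card_insert_if)
  then obtain w where "w \<in> V" "set w \<inter> {y, 1} = {}"
    using ex_tuple_avoiding[of "{y, 1}" "length \<alpha>" m] by blast
  then have "wit y \<in> V \<and> set (wit y) \<inter> {y, 1} = {}"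
    unfolding wit_def by (intro someI[of "\<lambda>w. w \<in> V \<and> set w \<inter> {y, 1} = {}"]) auto
  then show "wit y \<in> V" "y \<notin> set (wit y)" "1 \<notin> set (wit y)"
    by auto
qed

lemma one_label: "1 \<in> {1..m}"
  using size_m pos by simp

lemma wit_update: "(wit y)[i := y] \<in> V" "(wit y)[i := 1] \<in> V" if "y \<in> {1..m}"
  using wit[of y] tuples_list_update that one_label by blast+

text \<open>
  Cocycle relation: \<open>D\<^sub>i(x,y) = D\<^sub>i(x,1) - D\<^sub>i(y,1)\<close> holds on the nose when the three exchanges
  are made in the same tuple, so it holds modulo \<open>S\<close> in general.
\<close>
lemma exchange_\<delta>:
  assumes u: "u \<in> V" and i: "i < length \<alpha>" and y: "y \<in> {1..m}" "y \<notin> set u"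
  shows "frag_of u - frag_of (u[i := y]) - (\<delta> i (u ! i) - \<delta> i y) \<in> S"
proof -
  let ?x = "u ! i"
  have len: "length u = length \<alpha>" and x: "?x \<in> {1..m}"
    using u tuples_nth[OF u i] by (simp_all add: tuples_def)
  have "card {?x, y, 1} + length \<alpha> \<le> m"
    using size_m pos card_length[of "[?x, y, 1]"] by simp
  then obtain w where w: "w \<in> V" "set w \<inter> {?x, y, 1} = {}"
    using ex_tuple_avoiding[of "{?x, y, 1}" "length \<alpha>" m] by blast
  have wV: "w[i := ?x] \<in> V" "w[i := y] \<in> V" "w[i := 1] \<in> V"
    using tuples_list_update[OF w(1)] w(2) x y one_label by blast+
  have 1: "exchange i ?x y u - exchange i ?x y w \<in> S"
    using exchange_independent wV(1,2) i u tuples_list_update[OF u y] by simp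
  have 2: "exchange i ?x 1 w - \<delta> i ?x \<in> S" and 3: "exchange i y 1 w - \<delta> i y \<in> S"
    unfolding \<delta>_def using exchange_independent wV i wit_update x y by simp_all
  show ?thesis
    using diff_mem[OF add_mem[OF 1 2] 3] by (simp add: exchange_def algebra_simps)
qed

text \<open>
  What remains of a tuple after its labels have been moved to the origin one by one.
\<close>
definition residual :: "nat list \<Rightarrow> (nat list \<Rightarrow>\<^sub>0 int)" where
  "residual u = frag_of u - (\<Sum>i<length \<alpha>. \<delta> i (u ! i))"

lemma residual_update:
  assumes u: "u \<in> V" and i: "i < length \<alpha>" and y: "y \<in> {1..m}" "y \<notin> set u"
  shows "residual u - residual (u[i := y]) \<in> S"
proof -
  have len: "length u = length \<alpha>"
    using u by (simp add: tuples_def)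
  have "(\<Sum>l<length \<alpha>. \<delta> l (u ! l)) - (\<Sum>l<length \<alpha>. \<delta> l (u[i := y] ! l)) =
      (\<Sum>l<length \<alpha>. if l = i then \<delta> i (u ! i) - \<delta> i y else 0)"
    unfolding sum_subtractf[symmetric] by (rule sum.cong) (use i len in auto)
  also have "\<dots> = \<delta> i (u ! i) - \<delta> i y"
    using i by simp
  finally have sums: "(\<Sum>l<length \<alpha>. \<delta> l (u ! l)) - (\<Sum>l<length \<alpha>. \<delta> l (u[i := y] ! l)) =
      \<delta> i (u ! i) - \<delta> i y" .
  have "residual u - residual (u[i := y]) = frag_of u - frag_of (u[i := y]) -
      ((\<Sum>l<length \<alpha>. \<delta> l (u ! l)) - (\<Sum>l<length \<alpha>. \<delta> l (u[i := y] ! l)))"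
    by (simp add: residual_def)
  then show ?thesis
    unfolding sums using exchange_\<delta>[OF assms] by simp
qed

text \<open>
  Replace the labels of \<open>u\<close> by those of \<open>z\<close> from left to right.  As the two tuples have no label in
  common, the entries stay distinct on the way.
\<close>
lemma residual_disjoint:
  assumes u: "u \<in> V" and z: "z \<in> V" and disj: "set u \<inter> set z = {}"
  shows "residual u - residual z \<in> S"
proof -
  define h where "h t = take t z @ drop t u" for t
  have len: "length u = length \<alpha>" "length z = length \<alpha>"
    using u z by (simp_all add: tuples_def)
  have "h t \<in> V \<and> residual u - residual (h t) \<in> S" if "t \<le> length \<alpha>" for t
    using that
  proof (induction t)
    case 0
    then show ?case
      using u zero_mem by (simp add: h_def)
  next
    case (Suc t)
    then have t: "t < length \<alpha>" and IH: "h t \<in> V" "residual u - residual (h t) \<in> S"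
      by simp_all
    have step: "h (Suc t) = (h t)[t := z ! t]"
      using t len by (simp add: h_def take_Suc_conv_app_nth list_update_append
          drop_update_swap Cons_nth_drop_Suc[symmetric])
    have "z ! t \<in> set z"
      using t len by simp
    moreover have "z ! t \<notin> set (take t z)"
      using z t len by (auto simp: tuples_def in_set_conv_nth nth_eq_iff_index_eq)
    ultimately have new: "z ! t \<in> {1..m}" "z ! t \<notin> set (h t)"
      using z disj by (auto simp: tuples_def h_def dest: in_set_dropD)
    have "residual (h t) - residual (h (Suc t)) \<in> S"
      unfolding step by (rule residual_update[OF IH(1) t new])
    from add_mem[OF IH(2) this] show ?case
      using tuples_list_update[OF IH(1) new] by (simp add: step)
  qed
  from this[of "length \<alpha>"] show ?thesis
    using len by (simp add: h_def)
qed

text \<open>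
  Two arbitrary tuples are compared through a third one that is disjoint from both.
\<close>
lemma residual_constant:
  assumes "u \<in> V" "w \<in> V"
  shows "residual u - residual w \<in> S"
proof -
  have "card (set u \<union> set w) \<le> length u + length w"
    using card_Un_le[of "set u" "set w"] card_length[of u] card_length[of w] by linarith
  then have "card (set u \<union> set w) + length \<alpha> \<le> m"
    using assms size_m by (simp add: tuples_def)
  then obtain z where "z \<in> V" "set z \<inter> (set u \<union> set w) = {}"
    using ex_tuple_avoiding[of "set u \<union> set w" "length \<alpha>" m] by blast
  then have "residual u - residual z \<in> S" "residual w - residual z \<in> S"
    using residual_disjoint assms by blast+
  from diff_mem[OF this] show ?thesis
    by simp
qed

text \<open>
  If \<open>\<Sum>\<^sub>j s\<^sub>j \<beta>\<^sub>j = 1\<close> and \<open>\<Sum>\<^sub>i n\<^sub>i \<beta>\<^sub>i = 0\<close>, then \<open>\<Sum>\<^sub>i n\<^sub>i D\<^sub>i = \<Sum>\<^sub>i \<Sum>\<^sub>j n\<^sub>i s\<^sub>j (\<beta>\<^sub>j D\<^sub>i - \<beta>\<^sub>i D\<^sub>j)\<close>.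
  Dividing \<open>\<alpha>\<close> by its greatest common divisor \<open>g\<close> does not change its syzygies, and for
  \<open>\<beta> = \<alpha> / g\<close> a suitable \<open>s\<close> exists by Bezout.
\<close>
lemma \<delta>_syzygy:
  assumes y: "y \<in> {1..m}" and n: "(\<Sum>i<length \<alpha>. n i * int (\<alpha> ! i)) = 0" and d: "sum_list \<alpha> \<noteq> 0"
  shows "(\<Sum>i<length \<alpha>. frag_cmul (n i) (\<delta> i y)) \<in> S"
proof -
  let ?k = "length \<alpha>"
  obtain s g where s: "(\<Sum>i<?k. s i * int (\<alpha> ! i)) = int g" and g: "\<And>i. i < ?k \<Longrightarrow> g dvd \<alpha> ! i"
    using bezout_finite[of "{..<?k}" "\<lambda>i. \<alpha> ! i"] by auto
  have "g \<noteq> 0"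
  proof
    assume "g = 0"
    then have "\<forall>i<?k. \<alpha> ! i = 0"
      using g by simp
    then show False
      using d by (auto simp: sum_list_eq_0_iff in_set_conv_nth)
  qed
  define \<beta> where "\<beta> i = \<alpha> ! i div g" for i
  have \<beta>: "\<alpha> ! i = \<beta> i * g" if "i < ?k" for i
    using g[OF that] by (simp add: \<beta>_def)
  have le: "\<beta> i \<le> sum_list \<alpha>" if "i < ?k" for i
    unfolding \<beta>_def using member_le_sum_list[of "\<alpha> ! i" \<alpha>] that
    by (intro le_trans[OF div_le_dividend]) simp
  have "int g * (\<Sum>i<?k. s i * int (\<beta> i)) = (\<Sum>i<?k. s i * int (\<alpha> ! i))"
    unfolding sum_distrib_left by (rule sum.cong) (simp_all add: \<beta>)
  then have s\<beta>: "(\<Sum>i<?k. s i * int (\<beta> i)) = 1"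
    using s \<open>g \<noteq> 0\<close> by simp
  have "int g * (\<Sum>i<?k. n i * int (\<beta> i)) = (\<Sum>i<?k. n i * int (\<alpha> ! i))"
    unfolding sum_distrib_left by (rule sum.cong) (simp_all add: \<beta>)
  then have n\<beta>: "(\<Sum>i<?k. n i * int (\<beta> i)) = 0"
    using n \<open>g \<noteq> 0\<close> by simp
  have koszul: "frag_cmul (int (\<beta> j)) (\<delta> i y) - frag_cmul (int (\<beta> i)) (\<delta> j y) \<in> S"
    if "i < ?k" "j < ?k" for i j
    unfolding \<delta>_def
    by (rule exchange_relation)
      (use that wit_update[OF y] le[of i] le[of j] in \<open>auto simp: \<beta>\<close>)
  have "(\<Sum>i<?k. \<Sum>j<?k. frag_cmul (n i * s j)
      (frag_cmul (int (\<beta> j)) (\<delta> i y) - frag_cmul (int (\<beta> i)) (\<delta> j y))) \<in> S"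
    by (intro sum_mem cmul_mem koszul) auto
  moreover have "(\<Sum>i<?k. \<Sum>j<?k. frag_cmul (n i * s j)
      (frag_cmul (int (\<beta> j)) (\<delta> i y) - frag_cmul (int (\<beta> i)) (\<delta> j y))) =
      (\<Sum>i<?k. frag_cmul (n i) (\<delta> i y))" (is "?L = ?R")
  proof (rule poly_mapping_eqI)
    fix x
    let ?c = "\<lambda>i. Poly_Mapping.lookup (\<delta> i y) x"
    have "Poly_Mapping.lookup ?L x =
        (\<Sum>i<?k. \<Sum>j<?k. n i * ?c i * (s j * int (\<beta> j)) - n i * int (\<beta> i) * (s j * ?c j))"
      by (simp add: lookup_sum lookup_minus algebra_simps)
    also have "\<dots> = (\<Sum>i<?k. n i * ?c i) * (\<Sum>j<?k. s j * int (\<beta> j)) -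
        (\<Sum>i<?k. n i * int (\<beta> i)) * (\<Sum>j<?k. s j * ?c j)"
      by (simp only: sum_subtractf sum_product)
    also have "\<dots> = Poly_Mapping.lookup ?R x"
      by (simp add: s\<beta> n\<beta> lookup_sum)
    finally show "Poly_Mapping.lookup ?L x = Poly_Mapping.lookup ?R x" .
  qed
  ultimately show ?thesis
    by simp
qed

lemma constant_monomial:
  assumes "sum_list \<alpha> = 0" "Poly_Mapping.keys a \<subseteq> V"
  shows "a \<in> S"
  using assms(2)
proof (induction a rule: frag_induction)
  case (one u)
  have "\<alpha> ! i = 0" if "i < length \<alpha>" for i
    using assms(1) that by (simp add: sum_list_eq_0_iff)
  then have "weight \<alpha> (frag_of u) = 0"
    by (simp add: weight_frag_of)
  moreover have "card (set u) \<le> 2 * length \<alpha>"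
    using card_length[of u] one by (simp add: tuples_def)
  ultimately show ?case
    using binomial_mem[of "[u]" "[]"] one by simp
qed (simp_all add: zero_mem diff_mem)

text \<open>
  Write \<open>a = \<Sum>\<^sub>u c\<^sub>u u\<close>.  Modulo \<open>S\<close> the tuple \<open>u\<close> is a constant plus \<open>\<Sum>\<^sub>i \<delta>\<^sub>i(u\<^sub>i)\<close>.  The weight of \<open>a\<close>
  has total degree \<open>d \<Sum>\<^sub>u c\<^sub>u\<close>, so for \<open>d > 0\<close> the constants cancel; and its degree at \<open>t\<^sub>y\<close> is
  \<open>\<Sum>\<^sub>i \<alpha>\<^sub>i n\<^sub>i\<close>, where \<open>n\<^sub>i\<close> is the coefficient of \<open>\<delta>\<^sub>i(y)\<close>, so these coefficients form a syzygy.
\<close>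
lemma weight_kernel_mem:
  assumes a: "Poly_Mapping.keys a \<subseteq> V" and w: "weight \<alpha> a = 0"
  shows "a \<in> S"
proof (cases "sum_list \<alpha> = 0")
  case True
  then show ?thesis
    using constant_monomial a by blast
next
  case d: False
  let ?k = "length \<alpha>" and ?K = "Poly_Mapping.keys a" and ?c = "Poly_Mapping.lookup a"
  obtain u0 where u0: "u0 \<in> V"
    using wit(1) by blast
  \<comment> \<open>Forgetting the labels of the weight leaves its total degree.\<close>
  have "push (\<lambda>_. ()) (weight \<alpha> a) = Poly_Mapping.single () ((\<Sum>u\<in>?K. ?c u) * int (sum_list \<alpha>))"
  proof -
    have sum: "push (\<lambda>_. ()) (sum f A) = (\<Sum>x\<in>A. push (\<lambda>_. ()) (f x))"
      for f :: "'b \<Rightarrow> nat \<Rightarrow>\<^sub>0 int" and A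
      by (induction A rule: infinite_finite_induct) (simp_all add: push_add)
    have single: "Poly_Mapping.single () (sum f A) = (\<Sum>x\<in>A. Poly_Mapping.single () (f x))"
      for f :: "'b \<Rightarrow> int" and A
      by (induction A rule: infinite_finite_induct) (simp_all add: single_add)
    have "int (sum_list \<alpha>) = (\<Sum>i<?k. int (\<alpha> ! i))"
      by (simp add: sum_list_sum_nth atLeast0LessThan)
    then show ?thesis
      unfolding weight_def sum push_single by (simp add: single sum_product)
  qed
  then have total: "(\<Sum>u\<in>?K. ?c u) = 0"
    using w d by (metis lookup_single_eq lookup_zero mult_eq_0_iff of_nat_eq_0_iff push_0)
  define n where "n i y = (\<Sum>u\<in>?K. ?c u * of_bool (u ! i = y))" for i y
  have n: "(\<Sum>i<?k. n i y * int (\<alpha> ! i)) = 0" for y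
  proof -
    have "(\<Sum>i<?k. n i y * int (\<alpha> ! i)) = Poly_Mapping.lookup (weight \<alpha> a) y"
      unfolding weight_def n_def lookup_sum sum_distrib_right
      by (subst sum.swap) (auto simp: lookup_single when_def intro!: sum.cong)
    then show ?thesis
      by (simp add: w)
  qed
  have label: "u ! i \<in> {1..m}" if "u \<in> ?K" "i < ?k" for u i
    using tuples_nth a that by blast
  have "(\<Sum>y\<in>{1..m}. \<Sum>i<?k. frag_cmul (n i y) (\<delta> i y)) =
      (\<Sum>u\<in>?K. frag_cmul (?c u) (\<Sum>i<?k. \<delta> i (u ! i)))" (is "?L = ?R")
  proof (rule poly_mapping_eqI)
    fix x
    let ?e = "\<lambda>i y. Poly_Mapping.lookup (\<delta> i y) x"
    have "Poly_Mapping.lookup ?L x =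
        (\<Sum>y\<in>{1..m}. \<Sum>i<?k. \<Sum>u\<in>?K. ?c u * of_bool (u ! i = y) * ?e i y)"
      unfolding lookup_sum lookup_frag_cmul n_def sum_distrib_right by (rule refl)
    also have "\<dots> = (\<Sum>u\<in>?K. \<Sum>i<?k. \<Sum>y\<in>{1..m}. ?c u * of_bool (u ! i = y) * ?e i y)"
      by (subst sum.swap, subst (2) sum.swap, subst sum.swap) (rule refl)
    also have "\<dots> = (\<Sum>u\<in>?K. \<Sum>i<?k. ?c u * ?e i (u ! i))"
    proof (intro sum.cong refl)
      fix u i assume "u \<in> ?K" "i \<in> {..<?k}"
      have "(\<Sum>y\<in>{1..m}. ?c u * of_bool (u ! i = y) * ?e i y) =
          (\<Sum>y\<in>{1..m}. if y = u ! i then ?c u * ?e i (u ! i) else 0)"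
        by (rule sum.cong) auto
      then show "(\<Sum>y\<in>{1..m}. ?c u * of_bool (u ! i = y) * ?e i y) = ?c u * ?e i (u ! i)"
        using label[of u i] \<open>u \<in> ?K\<close> \<open>i \<in> {..<?k}\<close> by simp
    qed
    also have "\<dots> = Poly_Mapping.lookup ?R x"
      by (simp add: lookup_sum sum_distrib_left)
    finally show "Poly_Mapping.lookup ?L x = Poly_Mapping.lookup ?R x" .
  qed
  moreover have "(\<Sum>y\<in>{1..m}. \<Sum>i<?k. frag_cmul (n i y) (\<delta> i y)) \<in> S"
    by (intro sum_mem \<delta>_syzygy n d)
  ultimately have 1: "(\<Sum>u\<in>?K. frag_cmul (?c u) (\<Sum>i<?k. \<delta> i (u ! i))) \<in> S"
    by simp
  have 2: "(\<Sum>u\<in>?K. frag_cmul (?c u) (residual u - residual u0)) \<in> S"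
    using a u0 by (intro sum_mem cmul_mem residual_constant) auto
  have "a = (\<Sum>u\<in>?K. frag_cmul (?c u) (frag_of u))"
    using frag_expansion[of a] by (simp add: frag_extend_def)
  also have "\<dots> = (\<Sum>u\<in>?K. frag_cmul (?c u) (residual u - residual u0)) +
      (\<Sum>u\<in>?K. frag_cmul (?c u) (\<Sum>i<?k. \<delta> i (u ! i)))"
  proof (rule poly_mapping_eqI)
    fix x
    have "(\<Sum>u\<in>?K. ?c u * Poly_Mapping.lookup (residual u0) x) = 0"
      unfolding sum_distrib_right[symmetric] total by simp
    then show "Poly_Mapping.lookup (\<Sum>u\<in>?K. frag_cmul (?c u) (frag_of u)) x =
        Poly_Mapping.lookup ((\<Sum>u\<in>?K. frag_cmul (?c u) (residual u - residual u0)) +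
          (\<Sum>u\<in>?K. frag_cmul (?c u) (\<Sum>i<?k. \<delta> i (u ! i)))) x"
      by (simp add: lookup_sum lookup_add lookup_minus residual_def right_diff_distrib
          sum_subtractf sum.distrib del: lookup_frag_of)
  qed
  finally show ?thesis
    using add_mem[OF 2 1] by simp
qed

end

section \<open>Binomials generate the Laurent ideals\<close>

definition tuple_binomial :: "nat list list \<Rightarrow> nat list list \<Rightarrow> (nat list, 'a::field) lpoly" where
  "tuple_binomial U W = Poly_Mapping.single (exps U) 1 - Poly_Mapping.single (exps W) 1"

text \<open>
  Lists of tuples stand for monomials.  The condition on the weights says that the binomial is in the
  toric ideal, and the bound \<open>2 d + 2\<close> on the degree leaves finitely many binomials while admitting
  those in \<open>exchange_relation\<close>.
\<close>
definition balanced :: "nat list \<Rightarrow> nat \<Rightarrow> nat list list \<Rightarrow> nat list list \<Rightarrow> bool" where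
  "balanced \<alpha> n U W \<longleftrightarrow> set U \<union> set W \<subseteq> tuples (length \<alpha>) n \<and>
     length U \<le> 2 * sum_list \<alpha> + 2 \<and> length W \<le> 2 * sum_list \<alpha> + 2 \<and>
     weight \<alpha> (exps U) = weight \<alpha> (exps W)"

lemma keys_exps: "Poly_Mapping.keys (exps U) \<subseteq> set U"
proof (induction U)
  case (Cons u U)
  then show ?case
    using Poly_Mapping.keys_add[of "frag_of u" "exps U"] by auto
qed simp

lemma keys_binomial: "Poly_Mapping.keys (tuple_binomial U W) \<subseteq> {exps U, exps W}"
  unfolding tuple_binomial_def using keys_diff by fastforce

lemma binomial_in_toric_kernel: "(tuple_binomial U W :: (nat list, 'a::field) lpoly) \<in> toric_kernel \<alpha> n"
  if "balanced \<alpha> n U W"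
proof -
  let ?b = "tuple_binomial U W :: (nat list, 'a) lpoly"
  have "Poly_Mapping.keys a \<subseteq> tuples (length \<alpha>) n" if "a \<in> Poly_Mapping.keys ?b" for a
    using that keys_binomial[of U W] keys_exps[of U] keys_exps[of W] \<open>balanced \<alpha> n U W\<close>
    unfolding balanced_def by blast
  moreover have "push (weight \<alpha>) ?b = 0"
    using that by (simp add: tuple_binomial_def push_diff balanced_def)
  ultimately show ?thesis
    by (simp add: toric_kernel_def carrier_laurent_ring)
qed

lemma ideal_add: "p + q \<in> I" if "ideal I (laurent_ring V)" "p \<in> I" "q \<in> I"
  using additive_subgroup.a_closed[OF ideal.axioms(1)[OF that(1)] that(2,3)]
  by (simp add: laurent_ring_ops)

lemma ideal_mult: "q * p \<in> I"
  if "ideal I (laurent_ring V)" "p \<in> I" "q \<in> carrier (laurent_ring V)"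
  using ideal.I_l_closed[OF that] by (simp add: laurent_ring_ops)

lemma ideal_diff: "p - q \<in> I" if "ideal I (laurent_ring V)" "p \<in> I" "q \<in> I"
proof -
  have "- 1 \<in> carrier (laurent_ring V)"
    by (simp add: carrier_laurent_ring)
  from ideal_add[OF that(1,2) ideal_mult[OF that(1,3) this]] show ?thesis
    by simp
qed

lemma ideal_sum: "sum f A \<in> I"
  if I: "ideal I (laurent_ring V)" and f: "\<And>x. x \<in> A \<Longrightarrow> f x \<in> I"
proof -
  have "0 \<in> I"
    using additive_subgroup.zero_closed[OF ideal.axioms(1)[OF I]] by (simp add: laurent_ring_ops)
  then show ?thesis
    using f by (induction A rule: infinite_finite_induct) (auto intro: ideal_add[OF I])
qed

text \<open>
  Choose a representative \<open>s(y)\<close> of each weight \<open>y\<close>.  Modulo \<open>I\<close> each monomial \<open>x\<^sup>a\<close> equals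
  \<open>x\<^bsup>s(weight a)\<^esup>\<close>, so \<open>p\<close> is congruent to the push-forward of \<open>p\<close> along \<open>weight\<close> and then \<open>s\<close>,
  and the first of these two steps already gives zero.
\<close>
lemma toric_kernel_subset_ideal:
  fixes I :: "(nat list, 'a::field) lpoly set"
  assumes I: "ideal I (laurent_ring (tuples (length \<alpha>) m))"
    and pure: "\<And>a. Poly_Mapping.keys a \<subseteq> tuples (length \<alpha>) m \<Longrightarrow> weight \<alpha> a = 0 \<Longrightarrow>
      Poly_Mapping.single a 1 - 1 \<in> I"
  shows "toric_kernel \<alpha> m \<subseteq> I"
proof
  let ?V = "tuples (length \<alpha>) m"
  fix p :: "(nat list, 'a) lpoly"
  assume "p \<in> toric_kernel \<alpha> m"
  then have p0: "push (weight \<alpha>) p = 0" and pV: "\<forall>a\<in>Poly_Mapping.keys p. Poly_Mapping.keys a \<subseteq> ?V"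
    by (simp_all add: toric_kernel_def carrier_laurent_ring)
  define s where "s y = (SOME a :: nat list \<Rightarrow>\<^sub>0 int. Poly_Mapping.keys a \<subseteq> ?V \<and> weight \<alpha> a = y)" for y
  have s: "Poly_Mapping.keys (s (weight \<alpha> a)) \<subseteq> ?V \<and> weight \<alpha> (s (weight \<alpha> a)) = weight \<alpha> a"
    if "Poly_Mapping.keys a \<subseteq> ?V" for a
    unfolding s_def
    by (rule someI[of "\<lambda>b. Poly_Mapping.keys b \<subseteq> ?V \<and> weight \<alpha> b = weight \<alpha> a" a]) (use that in simp)
  have "Poly_Mapping.single a c - Poly_Mapping.single (s (weight \<alpha> a)) c \<in> I"
    if a: "Poly_Mapping.keys a \<subseteq> ?V" for a c
  proof -
    let ?b = "s (weight \<alpha> a)"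
    have "Poly_Mapping.keys (a - ?b) \<subseteq> ?V"
      using keys_diff[of a ?b] a s[OF a] by blast
    moreover have "weight \<alpha> (a - ?b) = 0"
      using s[OF a] by (simp add: weight_diff)
    ultimately have "Poly_Mapping.single (a - ?b) 1 - 1 \<in> I"
      by (rule pure)
    moreover have "Poly_Mapping.single ?b c \<in> carrier (laurent_ring ?V)"
      using s[OF a] by (simp add: carrier_laurent_ring)
    ultimately have "Poly_Mapping.single ?b c * (Poly_Mapping.single (a - ?b) 1 - 1) \<in> I"
      by (rule ideal_mult[OF I])
    then show ?thesis
      by (simp add: right_diff_distrib mult_single)
  qed
  then have "(\<Sum>a\<in>Poly_Mapping.keys p. Poly_Mapping.single a (Poly_Mapping.lookup p a) -
      Poly_Mapping.single (s (weight \<alpha> a)) (Poly_Mapping.lookup p a)) \<in> I"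
    using pV by (intro ideal_sum[OF I]) blast
  then have "push (\<lambda>a. a) p - push (\<lambda>a. s (weight \<alpha> a)) p \<in> I"
    by (simp add: push_def sum_subtractf)
  moreover have "push (\<lambda>a. s (weight \<alpha> a)) p = push s (push (weight \<alpha>) p)"
    by (simp add: push_push)
  ultimately show "p \<in> I"
    by (simp add: push_ident p0)
qed

text \<open>
  The vectors \<open>a\<close> with \<open>x\<^sup>a - 1 \<in> I\<close> form a subgroup, since
  \<open>x\<^bsup>a-b\<^esup> - 1 = x\<^bsup>-b\<^esup> (x\<^sup>a - x\<^sup>b)\<close>; for the same reason it contains the difference of the exponent
  vectors of each binomial in \<open>I\<close>.  The hypothesis is restricted to binomials in at most \<open>2 k\<close> labels,
  because only those are known to be permuted from level \<open>4 k\<close>.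
\<close>
lemma toric_kernel_generated_by_binomials:
  fixes I :: "(nat list, 'a::field) lpoly set"
  assumes I: "ideal I (laurent_ring (tuples (length \<alpha>) m))"
    and m: "4 * length \<alpha> \<le> m" "1 \<le> length \<alpha>"
    and binomials: "\<And>U W. balanced \<alpha> m U W \<Longrightarrow>
      card (\<Union>(set ` (set U \<union> set W))) \<le> 2 * length \<alpha> \<Longrightarrow> tuple_binomial U W \<in> I"
  shows "toric_kernel \<alpha> m \<subseteq> I"
proof -
  let ?V = "tuples (length \<alpha>) m"
  define S where "S = {a. Poly_Mapping.keys a \<subseteq> ?V \<and> Poly_Mapping.single a 1 - 1 \<in> I}"
  have pure_quotient: "Poly_Mapping.single (a - b) 1 - 1 \<in> I"
    if "Poly_Mapping.keys b \<subseteq> ?V" "Poly_Mapping.single a 1 - Poly_Mapping.single b 1 \<in> I" for a b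
  proof -
    have "Poly_Mapping.single (- b) (1::'a) \<in> carrier (laurent_ring ?V)"
      using that(1) by (simp add: carrier_laurent_ring)
    from ideal_mult[OF I that(2) this] show ?thesis
      by (simp add: right_diff_distrib mult_single)
  qed
  interpret binomial_lattice \<alpha> m S
  proof
    show "0 \<in> S"
      using additive_subgroup.zero_closed[OF ideal.axioms(1)[OF I]]
      by (simp add: S_def laurent_ring_ops)
    show "a - b \<in> S" if "a \<in> S" "b \<in> S" for a b
    proof -
      have ab: "Poly_Mapping.keys a \<subseteq> ?V" "Poly_Mapping.single a 1 - 1 \<in> I"
        "Poly_Mapping.keys b \<subseteq> ?V" "Poly_Mapping.single b 1 - 1 \<in> I"
        using that by (simp_all add: S_def)
      have "Poly_Mapping.single a 1 - Poly_Mapping.single b 1 \<in> I"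
        using ideal_diff[OF I ab(2,4)] by simp
      then show ?thesis
        using pure_quotient[OF ab(3)] ab(1,3) keys_diff[of a b] by (auto simp: S_def)
    qed
    show "exps U - exps W \<in> S"
      if "set U \<union> set W \<subseteq> ?V" "length U \<le> 2 * sum_list \<alpha> + 2" "length W \<le> 2 * sum_list \<alpha> + 2"
        "card (\<Union>(set ` (set U \<union> set W))) \<le> 2 * length \<alpha>"
        "weight \<alpha> (exps U) = weight \<alpha> (exps W)" for U W
    proof -
      have "tuple_binomial U W \<in> I"
        using that by (intro binomials) (simp_all add: balanced_def)
      moreover have "Poly_Mapping.keys (exps U) \<subseteq> ?V" "Poly_Mapping.keys (exps W) \<subseteq> ?V"
        using keys_exps that(1) by blast+
      ultimately show ?thesis
        using pure_quotient keys_diff[of "exps U" "exps W"] by (auto simp: S_def tuple_binomial_def)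
    qed
  qed (use m in simp_all)
  show ?thesis
    using weight_kernel_mem by (intro toric_kernel_subset_ideal[OF I]) (auto simp: S_def)
qed

lemma stabilization_bound_toric_kernel:
  assumes "1 \<le> length \<alpha>"
  shows "stabilization_bound (length \<alpha>) (toric_kernel \<alpha> :: nat \<Rightarrow> (nat list, 'a::field) lpoly set)
    (4 * length \<alpha>)"
  unfolding stabilization_bound_def
proof (intro conjI allI impI equalityI)
  let ?N = "4 * length \<alpha>" and ?J = "toric_kernel \<alpha> :: nat \<Rightarrow> (nat list, 'a::field) lpoly set"
  fix m assume m: "?N \<le> m"
  let ?R = "laurent_ring (tuples (length \<alpha>) m) :: (nat list, 'a) lpoly ring"
  interpret cring ?R by (rule cring_laurent_ring)
  have orbit: "sym_orbit m (?J ?N) \<subseteq> ?J m"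
    by (rule sym_orbit_toric_kernel[OF m])
  then show "Idl\<^bsub>?R\<^esub> (sym_orbit m (?J ?N)) \<subseteq> ?J m"
    by (rule genideal_minimal[OF ideal_toric_kernel])
  have carrier: "sym_orbit m (?J ?N) \<subseteq> carrier ?R"
    using orbit by (auto simp: toric_kernel_def)
  show "?J m \<subseteq> Idl\<^bsub>?R\<^esub> (sym_orbit m (?J ?N))"
  proof (rule toric_kernel_generated_by_binomials[OF genideal_ideal[OF carrier] m assms])
    fix U W :: "nat list list"
    let ?Y = "\<Union>(set ` (set U \<union> set W))"
    assume UW: "balanced \<alpha> m U W" "card ?Y \<le> 2 * length \<alpha>"
    have "tuple_binomial U W \<in> sym_orbit m (?J ?N)"
    proof (rule toric_kernel_in_sym_orbit[OF binomial_in_toric_kernel[OF UW(1)]])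
      show "card ?Y \<le> ?N"
        using UW(2) by simp
      show "?Y \<subseteq> {1..m}"
        using UW(1) by (auto simp: balanced_def tuples_def)
      show "set u \<subseteq> ?Y"
        if "a \<in> Poly_Mapping.keys (tuple_binomial U W :: (nat list, 'a) lpoly)" "u \<in> Poly_Mapping.keys a" for a u
        using that keys_binomial[of U W] keys_exps[of U] keys_exps[of W] by blast
    qed (rule m)
    then show "tuple_binomial U W \<in> Idl\<^bsub>?R\<^esub> (sym_orbit m (?J ?N))"
      using genideal_self[OF carrier] by blast
  qed
qed simp

text \<open>
  At level \<open>4 k\<close> the binomials must generate the ideal without help from the permutations, so all of
  them are taken and not only one from each orbit.
\<close>
lemma chain_generators_binomials:
  assumes "1 \<le> length \<alpha>"
  shows "chain_generators (length \<alpha>) (toric_kernel \<alpha>) (4 * length \<alpha>)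
    {tuple_binomial U W :: (nat list, 'a::field) lpoly | U W. balanced \<alpha> (4 * length \<alpha>) U W}"
  unfolding chain_generators_def
proof (intro conjI equalityI)
  let ?N = "4 * length \<alpha>"
  let ?R = "laurent_ring (tuples (length \<alpha>) ?N) :: (nat list, 'a) lpoly ring"
  let ?G = "{tuple_binomial U W :: (nat list, 'a::field) lpoly | U W. balanced \<alpha> ?N U W}"
  interpret cring ?R by (rule cring_laurent_ring)
  show "stabilization_bound (length \<alpha>) (toric_kernel \<alpha> :: nat \<Rightarrow> (nat list, 'a) lpoly set) ?N"
    using assms by (rule stabilization_bound_toric_kernel)
  have G: "?G \<subseteq> toric_kernel \<alpha> ?N"
    using binomial_in_toric_kernel by blast
  then show carrier: "?G \<subseteq> carrier ?R"
    by (auto simp: toric_kernel_def)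
  show "Idl\<^bsub>?R\<^esub> ?G \<subseteq> toric_kernel \<alpha> ?N"
    by (rule genideal_minimal[OF ideal_toric_kernel G])
  show "toric_kernel \<alpha> ?N \<subseteq> Idl\<^bsub>?R\<^esub> ?G"
    by (rule toric_kernel_generated_by_binomials[OF genideal_ideal[OF carrier] le_refl assms])
      (use genideal_self[OF carrier] in blast)
qed

section \<open>Computable functions\<close>

text \<open>
  Total computability by a program, on natural numbers.  The introduction rules below derive the
  computability of a function from the shape of its body.  Where a body has further variables (the
  index of a sum, say), the premise speaks of a single argument \<open>z\<close> that encodes the pair of the
  outer argument and the variable.
\<close>
definition computable :: "(nat \<Rightarrow> nat) \<Rightarrow> bool" where
  "computable f \<longleftrightarrow> (\<exists>P. \<forall>x. run P x (f x))"

definition decidable :: "(nat \<Rightarrow> bool) \<Rightarrow> bool" where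
  "decidable Q \<longleftrightarrow> computable (\<lambda>x. of_bool (Q x))"

lemma computable_comp: "computable (\<lambda>x. f (g x))" if "computable f" "computable g"
  using that unfolding computable_def by (metis run_comp)

lemma computable_fst: "computable (\<lambda>x. fst (prod_decode (f x)))" if "computable f"
proof (rule computable_comp[OF _ that])
  have "run PFst x (fst (prod_decode x))" for x
    using run_fst[of "fst (prod_decode x)" "snd (prod_decode x)"] by simp
  then show "computable (\<lambda>x. fst (prod_decode x))"
    unfolding computable_def by blast
qed

lemma computable_snd: "computable (\<lambda>x. snd (prod_decode (f x)))" if "computable f"
proof (rule computable_comp[OF _ that])
  have "run PSnd x (snd (prod_decode x))" for x
    using run_snd[of "fst (prod_decode x)" "snd (prod_decode x)"] by simp
  then show "computable (\<lambda>x. snd (prod_decode x))"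
    unfolding computable_def by blast
qed

lemma computable_pair: "computable (\<lambda>x. prod_encode (f x, g x))" if "computable f" "computable g"
  using that unfolding computable_def by (metis run_pair)

lemma computable_id: "computable (\<lambda>x. x)"
proof -
  have "run (PPair PFst PSnd) x x" for x
    using run_pair[OF run_fst run_snd, of "fst (prod_decode x)" "snd (prod_decode x)"] by simp
  then show ?thesis
    unfolding computable_def by blast
qed

lemma computable_Suc: "computable (\<lambda>x. Suc (f x))" if "computable f"
  by (rule computable_comp[OF _ that]) (use run_succ in \<open>auto simp: computable_def\<close>)

lemma computable_const: "computable (\<lambda>x. c)"
proof (induction c)
  case 0
  show ?case
    using run_zero unfolding computable_def by blast
qed (rule computable_Suc)

text \<open>
  Primitive recursion, where the parameter \<open>x\<close> remains available in each step.
\<close>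
lemma computable_rec_nat:
  assumes "computable a"
    and step: "computable (\<lambda>z. step (fst (prod_decode z)) (fst (prod_decode (snd (prod_decode z))))
                (snd (prod_decode (snd (prod_decode z)))))"
    and "computable n"
  shows "computable (\<lambda>x. rec_nat (a x) (step x) (n x))"
proof -
  obtain A where A: "run A x (a x)" for x
    using assms(1) unfolding computable_def by blast
  obtain S where "run S z (step (fst (prod_decode z)) (fst (prod_decode (snd (prod_decode z))))
      (snd (prod_decode (snd (prod_decode z)))))" for z
    using step unfolding computable_def by blast
  from this[of "prod_encode (x, prod_encode (i, y))" for x i y]
  have S: "run S (prod_encode (x, prod_encode (i, y))) (step x i y)" for x i y
    by simp
  have "run (PRec A S) (prod_encode (x, i)) (rec_nat (a x) (step x) i)" for x i
    by (induction i) (auto intro: run_rec_0 A run_rec_Suc S)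
  then have "computable (\<lambda>z. rec_nat (a (fst (prod_decode z))) (step (fst (prod_decode z)))
      (snd (prod_decode z)))"
    unfolding computable_def by (metis prod.collapse prod_decode_inverse)
  from computable_comp[OF this computable_pair[OF computable_id assms(3)]] show ?thesis
    by simp
qed

lemmas computable_intros =
  computable_id computable_const computable_fst computable_snd computable_pair computable_Suc

lemma computable_add: "computable (\<lambda>x. f x + g x)" if "computable f" "computable g"
proof -
  have "rec_nat a (\<lambda>_. Suc) b = a + b" for a b
    by (induction b) auto
  moreover have "computable (\<lambda>x. rec_nat (f x) (\<lambda>_. Suc) (g x))"
    by (intro computable_rec_nat computable_intros that)
  ultimately show ?thesis
    by simp
qed

lemma computable_mult: "computable (\<lambda>x. f x * g x)" if "computable f" "computable g"
proof -
  have "rec_nat 0 (\<lambda>_ y. y + a) b = a * b" for a b :: nat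
    by (induction b) auto
  moreover have "computable (\<lambda>x. rec_nat 0 (\<lambda>_ y. y + f x) (g x))"
    by (intro computable_rec_nat computable_add computable_intros computable_comp[OF that(1)] that)
  ultimately show ?thesis
    by simp
qed

lemma computable_diff: "computable (\<lambda>x. f x - g x)" if "computable f" "computable g"
proof -
  have "rec_nat 0 (\<lambda>i _. i) a = a - 1" for a :: nat
    by (cases a) auto
  moreover have "computable (\<lambda>x. rec_nat 0 (\<lambda>i _. i) (h x))" if "computable h" for h
    by (intro computable_rec_nat computable_intros that)
  ultimately have pred: "computable (\<lambda>x. h x - 1)" if "computable h" for h
    using that by simp
  have "rec_nat a (\<lambda>_ y. y - 1) b = a - b" for a b :: nat
    by (induction b) auto
  moreover have "computable (\<lambda>x. rec_nat (f x) (\<lambda>_ y. y - 1) (g x))"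
    by (intro computable_rec_nat pred computable_intros that)
  ultimately show ?thesis
    by simp
qed

lemma decidable_le: "decidable (\<lambda>x. f x \<le> g x)" if "computable f" "computable g"
proof -
  have eq: "of_bool (a \<le> b) = 1 - (a - b)" for a b :: nat
    by simp
  show ?thesis
    unfolding decidable_def eq by (intro computable_diff computable_intros that)
qed

lemma decidable_conj: "decidable (\<lambda>x. P x \<and> Q x)" if "decidable P" "decidable Q"
  using that unfolding decidable_def of_bool_conj by (intro computable_mult)

lemma decidable_not: "decidable (\<lambda>x. \<not> P x)" if "decidable P"
proof -
  have eq: "of_bool (\<not> b) = (1 - of_bool b :: nat)" for b
    by simp
  show ?thesis
    using that unfolding decidable_def eq by (intro computable_diff computable_intros)
qed

lemma decidable_eq: "decidable (\<lambda>x. f x = g x)" if "computable f" "computable g"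
  using that unfolding order_eq_iff by (intro decidable_conj decidable_le)

lemma computable_of_bool: "computable (\<lambda>x. of_bool (P x))" if "decidable P"
  using that unfolding decidable_def .

lemma computable_if: "computable (\<lambda>x. if P x then f x else g x)"
  if "decidable P" "computable f" "computable g"
proof -
  have "(if P x then f x else g x) = of_bool (P x) * f x + of_bool (\<not> P x) * g x" for x
    by simp
  then show ?thesis
    using that
    by (simp only:) (intro computable_add computable_mult computable_of_bool decidable_not)
qed

lemma computable_sum:
  assumes "computable (\<lambda>z. F (fst (prod_decode z)) (snd (prod_decode z)))" "computable n"
  shows "computable (\<lambda>x. \<Sum>i<n x. F x i)"
proof -
  have eq: "(\<Sum>i<b. G i) = rec_nat 0 (\<lambda>i y. y + G i) b" for b and G :: "nat \<Rightarrow> nat"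
    by (induction b) auto
  have F: "computable (\<lambda>x. F (f x) (g x))" if "computable f" "computable g" for f g
    using computable_comp[OF assms(1) computable_pair[OF that]] by simp
  show ?thesis
    unfolding eq by (intro computable_rec_nat computable_add F computable_intros assms(2))
qed

lemma decidable_all_less:
  assumes "decidable (\<lambda>z. Q (fst (prod_decode z)) (snd (prod_decode z)))" "computable n"
  shows "decidable (\<lambda>x. \<forall>i<n x. Q x i)"
proof -
  have eq: "(\<forall>i<n x. Q x i) \<longleftrightarrow> (\<Sum>i<n x. of_bool (\<not> Q x i) :: nat) = 0" for x
    by (auto simp: sum_nonneg_eq_0_iff)
  show ?thesis
    unfolding eq
    by (intro decidable_eq computable_sum computable_of_bool decidable_not computable_intros assms)
qed

text \<open>
  The code of a list is built from its end, so the \<open>i\<close>-th step of the recursion treats the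
  \<open>i\<close>-th index from above.
\<close>
lemma computable_list_encode_filter:
  assumes F: "computable (\<lambda>z. F (fst (prod_decode z)) (snd (prod_decode z)))"
    and Q: "decidable (\<lambda>z. Q (fst (prod_decode z)) (snd (prod_decode z)))"
    and n: "computable n"
  shows "computable (\<lambda>x. list_encode (map (F x) (filter (Q x) [0..<n x])))"
proof -
  define step where "step x i y =
    (if Q x (n x - Suc i) then Suc (prod_encode (F x (n x - Suc i), y)) else y)" for x i y
  have "rec_nat 0 (step x) t = list_encode (map (F x) (filter (Q x) [n x - t..<n x]))"
    if "t \<le> n x" for x t
    using that
  proof (induction t)
    case (Suc t)
    then have "[n x - Suc t..<n x] = (n x - Suc t) # [n x - t..<n x]"
      by (metis Suc_diff_Suc Suc_le_eq diff_less_Suc upt_conv_Cons zero_less_Suc diff_less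
          order_less_le_trans less_Suc_eq_0_disj)
    then show ?case
      using Suc by (simp add: step_def)
  qed simp
  from this[of "n x" x for x]
  have eq: "list_encode (map (F x) (filter (Q x) [0..<n x])) = rec_nat 0 (step x) (n x)" for x
    by simp
  have n': "computable (\<lambda>x. n (f x))" if "computable f" for f
    by (rule computable_comp[OF n that])
  have F': "computable (\<lambda>x. F (f x) (g x))" if "computable f" "computable g" for f g
    using computable_comp[OF F computable_pair[OF that]] by simp
  have Q': "decidable (\<lambda>x. Q (f x) (g x))" if "computable f" "computable g" for f g
    using computable_comp[OF Q[unfolded decidable_def] computable_pair[OF that]]
    unfolding decidable_def by simp
  show ?thesis
    unfolding eq step_def
    by (intro computable_rec_nat computable_if Q' computable_diff computable_Suc computable_pair
        F' n' computable_intros)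
qed

lemma computable_list_encode:
  assumes "computable (\<lambda>z. F (fst (prod_decode z)) (snd (prod_decode z)))" "computable n"
  shows "computable (\<lambda>x. list_encode (map (F x) [0..<n x]))"
proof -
  have "decidable (\<lambda>z. True)"
    unfolding decidable_def by (rule computable_const)
  from computable_list_encode_filter[OF assms(1) this assms(2)] show ?thesis
    by simp
qed

text \<open>
  On codes, \<open>c - 1\<close> is the code of the pair of head and tail for \<open>c > 0\<close>.  For \<open>c = 0\<close>, the empty
  list, truncated subtraction gives the code 0 of the pair \<open>(0, 0)\<close>, hence the tail 0 without a case
  distinction.
\<close>
definition code_tl :: "nat \<Rightarrow> nat" where
  "code_tl c = snd (prod_decode (c - 1))"

definition code_nth :: "nat \<Rightarrow> nat \<Rightarrow> nat" where
  "code_nth c i = fst (prod_decode (rec_nat c (\<lambda>_. code_tl) i - 1))"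

lemma list_decode_code_tl: "list_decode (code_tl c) = tl (list_decode c)"
proof (cases c)
  case 0
  have "prod_decode 0 = (0, 0)"
    using prod_encode_inverse[of "(0, 0)"] by (simp add: prod_encode_def)
  then show ?thesis
    using 0 by (simp add: code_tl_def)
qed (simp add: code_tl_def split: prod.split)

lemma list_decode_iterate_code_tl: "list_decode (rec_nat c (\<lambda>_. code_tl) i) = drop i (list_decode c)"
  by (induction i) (simp_all add: list_decode_code_tl drop_Suc tl_drop)

lemma list_decode_eq_Nil_iff: "list_decode c = [] \<longleftrightarrow> c = 0"
  by (metis list_decode.simps(1) list_decode_eq)

lemma code_nth: "code_nth c i = list_decode c ! i" if "i < length (list_decode c)"
proof -
  let ?r = "rec_nat c (\<lambda>_. code_tl) i"
  have "list_decode ?r \<noteq> []"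
    using that by (simp add: list_decode_iterate_code_tl)
  then have "hd (list_decode ?r) = fst (prod_decode (?r - 1))"
    by (cases ?r) (simp_all split: prod.split)
  then show ?thesis
    using that by (simp add: code_nth_def list_decode_iterate_code_tl hd_drop_conv_nth)
qed

lemma length_le_list_encode: "length xs \<le> list_encode xs"
  by (induction xs) (auto intro: le_trans[OF _ le_prod_encode_2])

text \<open>
  A list is shorter than its code, so the length is found by counting, below the code, how many
  iterated tails are nonempty.
\<close>
lemma length_list_decode:
  "length (list_decode c) = (\<Sum>i<c. of_bool (\<not> rec_nat c (\<lambda>_. code_tl) i = 0))"
proof -
  have "rec_nat c (\<lambda>_. code_tl) i = 0 \<longleftrightarrow> length (list_decode c) \<le> i" for i
    using list_decode_eq_Nil_iff[of "rec_nat c (\<lambda>_. code_tl) i"]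
    by (simp add: list_decode_iterate_code_tl)
  moreover have "{i. i < c \<and> i < length (list_decode c)} = {..<length (list_decode c)}"
    using length_le_list_encode[of "list_decode c"] by auto
  ultimately show ?thesis
    by (simp add: sum.If_cases of_bool_def Int_def not_le)
qed

lemma computable_code_tl: "computable (\<lambda>x. code_tl (f x))" if "computable f"
  unfolding code_tl_def by (intro computable_diff computable_intros that)

lemma computable_code_nth: "computable (\<lambda>x. code_nth (f x) (g x))"
  if "computable f" "computable g"
  unfolding code_nth_def
  by (intro computable_diff computable_rec_nat computable_code_tl computable_intros that)

lemma computable_length: "computable (\<lambda>x. length (list_decode (f x)))" if "computable f"
proof (rule computable_comp[OF _ that])
  show "computable (\<lambda>c. length (list_decode c))"
    unfolding length_list_decode
    by (intro computable_sum computable_of_bool decidable_not decidable_eq computable_rec_nat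
        computable_code_tl computable_intros)
qed

lemma map_code_nth: "map (\<lambda>i. h (code_nth c i)) [0..<length (list_decode c)] = map h (list_decode c)"
  by (rule nth_equalityI) (simp_all add: code_nth)

lemma computable_list_map:
  assumes "computable h" "computable f"
  shows "computable (\<lambda>x. list_encode (map h (list_decode (f x))))"
proof (rule computable_comp[OF _ assms(2)])
  show "computable (\<lambda>c. list_encode (map h (list_decode c)))"
    unfolding map_code_nth[symmetric]
    by (intro computable_list_encode computable_comp[OF assms(1)] computable_code_nth
        computable_length computable_intros)
qed

lemma prod_encode_mono: "prod_encode (a, b) \<le> prod_encode (c, d)" if "a \<le> c" "b \<le> d"
proof -
  have "triangle (a + b) \<le> triangle (c + d)"
    unfolding triangle_def using that by (intro div_le_mono mult_le_mono) auto
  then show ?thesis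
    using that by (simp add: prod_encode_def)
qed

lemma list_encode_le_replicate:
  assumes "length xs \<le> n" "\<And>x. x \<in> set xs \<Longrightarrow> x \<le> b"
  shows "list_encode xs \<le> list_encode (replicate n b)"
  using assms
proof (induction xs arbitrary: n)
  case (Cons x xs)
  then obtain n' where "n = Suc n'" "length xs \<le> n'"
    by (cases n) auto
  with Cons show ?case
    by (auto intro!: prod_encode_mono)
qed simp

section \<open>Listing the binomials by a program\<close>

lemma decidable_comp: "decidable (\<lambda>x. P (f x))" if "decidable P" "computable f"
  using that unfolding decidable_def by (rule computable_comp)

text \<open>
  A number is read as the code of a pair of codes of lists of codes of tuples: the two sides of a
  binomial.
\<close>
definition lhs :: "nat \<Rightarrow> nat list list" where
  "lhs c = map list_decode (list_decode (fst (prod_decode c)))"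

definition rhs :: "nat \<Rightarrow> nat list list" where
  "rhs c = map list_decode (list_decode (snd (prod_decode c)))"

text \<open>
  The code of the longest admissible list, all of whose entries are the largest bound for the code of
  a tuple.  List codes grow with the length and with the entries, so it bounds the code of each side
  of a balanced binomial.
\<close>
definition code_bound :: "nat list \<Rightarrow> nat" where
  "code_bound \<alpha> = list_encode (replicate (2 * sum_list \<alpha> + 2)
     (list_encode (replicate (length \<alpha>) (4 * length \<alpha>))))"

definition binomial_terms :: "nat \<Rightarrow> lpoly_term list" where
  "binomial_terms c = [(1, map (\<lambda>u. (u, 1)) (lhs c)), (-1, map (\<lambda>u. (u, 1)) (rhs c))]"

definition generator_list :: "nat list \<Rightarrow> lpoly_term list list" where
  "generator_list \<alpha> = map binomial_terms
     (filter (\<lambda>c. balanced \<alpha> (4 * length \<alpha>) (lhs c) (rhs c))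
       [0..<Suc (prod_encode (code_bound \<alpha>, code_bound \<alpha>))])"

lemma lpoly_of_binomial_terms: "lpoly_of_terms (binomial_terms c) = tuple_binomial (lhs c) (rhs c)"
  by (simp add: lpoly_of_terms_def binomial_terms_def tuple_binomial_def exps_def comp_def single_uminus)

lemma list_encode_le_code_bound:
  assumes "set U \<subseteq> tuples (length \<alpha>) (4 * length \<alpha>)" "length U \<le> 2 * sum_list \<alpha> + 2"
  shows "list_encode (map list_encode U) \<le> code_bound \<alpha>"
  unfolding code_bound_def
proof (rule list_encode_le_replicate)
  fix x assume "x \<in> set (map list_encode U)"
  then obtain u where "x = list_encode u" "u \<in> tuples (length \<alpha>) (4 * length \<alpha>)"
    using assms(1) by auto
  then show "x \<le> list_encode (replicate (length \<alpha>) (4 * length \<alpha>))"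
    by (auto intro!: list_encode_le_replicate simp: tuples_def)
qed (use assms in simp)

lemma set_generator_list:
  "lpoly_of_terms ` set (generator_list \<alpha>) =
     {tuple_binomial U W :: (nat list, 'a::field) lpoly | U W. balanced \<alpha> (4 * length \<alpha>) U W}"
proof -
  let ?N = "4 * length \<alpha>" and ?B = "code_bound \<alpha>"
  have "\<exists>c < Suc (prod_encode (?B, ?B)). lhs c = U \<and> rhs c = W" if "balanced \<alpha> ?N U W" for U W
  proof (intro exI conjI)
    let ?c = "prod_encode (list_encode (map list_encode U), list_encode (map list_encode W))"
    show "?c < Suc (prod_encode (?B, ?B))"
      using that unfolding balanced_def less_Suc_eq_le
      by (intro prod_encode_mono list_encode_le_code_bound) auto
    show "lhs ?c = U" "rhs ?c = W"
      by (simp_all add: lhs_def rhs_def comp_def)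
  qed
  then have "{tuple_binomial U W :: (nat list, 'a) lpoly | U W. balanced \<alpha> ?N U W} =
      (\<lambda>c. tuple_binomial (lhs c) (rhs c)) `
        {c. c < Suc (prod_encode (?B, ?B)) \<and> balanced \<alpha> ?N (lhs c) (rhs c)}"
    by blast
  moreover have "lpoly_of_terms ` set (generator_list \<alpha>) =
      (\<lambda>c. tuple_binomial (lhs c) (rhs c) :: (nat list, 'a) lpoly) `
        {c. c < Suc (prod_encode (?B, ?B)) \<and> balanced \<alpha> ?N (lhs c) (rhs c)}"
    unfolding generator_list_def set_map set_filter set_upt image_image lpoly_of_binomial_terms
    by (intro image_cong) auto
  ultimately show ?thesis
    by simp
qed

lemma list_decode_in_tuples_iff:
  "list_decode c \<in> tuples k n \<longleftrightarrow> length (list_decode c) = k \<and>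
     (\<forall>i<k. 1 \<le> code_nth c i \<and> code_nth c i \<le> n) \<and> (\<forall>i<k. \<forall>j<i. \<not> code_nth c i = code_nth c j)"
proof (cases "length (list_decode c) = k")
  case True
  then have "set (list_decode c) = code_nth c ` {..<k}"
    by (auto simp: set_conv_nth code_nth)
  moreover have "distinct (list_decode c) \<longleftrightarrow> (\<forall>i<k. \<forall>j<i. \<not> code_nth c i = code_nth c j)"
    unfolding distinct_conv_nth True
    by (auto simp: code_nth True) (metis linorder_neqE_nat)
  ultimately show ?thesis
    using True by (auto simp: tuples_def)
qed (simp add: tuples_def)

lemma decidable_tuples:
  "decidable (\<lambda>x. list_decode (c x) \<in> tuples (k x) (n x))"
  if "computable c" "computable k" "computable n"
proof -
  have "decidable (\<lambda>z. list_decode (fst (prod_decode z)) \<in>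
      tuples (fst (prod_decode (snd (prod_decode z)))) (snd (prod_decode (snd (prod_decode z)))))"
    unfolding list_decode_in_tuples_iff
    by (intro decidable_conj decidable_all_less decidable_eq decidable_le decidable_not
        computable_length computable_code_nth computable_intros)
  from decidable_comp[OF this computable_pair[OF that(1) computable_pair[OF that(2,3)]]]
  show ?thesis
    by simp
qed

text \<open>
  The degree in \<open>t\<^sub>y\<close> of the image of the monomial with code \<open>c\<close>, where \<open>a\<close> is the code of \<open>\<alpha>\<close>.
\<close>
definition degree_at :: "nat \<Rightarrow> nat \<Rightarrow> nat \<Rightarrow> nat" where
  "degree_at a y c = (\<Sum>l<length (list_decode c). \<Sum>i<length (list_decode a).
     code_nth a i * of_bool (code_nth (code_nth c l) i = y))"

lemma computable_degree_at: "computable (\<lambda>x. degree_at (a x) (y x) (c x))"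
  if "computable a" "computable y" "computable c"
proof -
  have "computable (\<lambda>z. degree_at (fst (prod_decode z)) (fst (prod_decode (snd (prod_decode z))))
      (snd (prod_decode (snd (prod_decode z)))))"
    unfolding degree_at_def
    by (intro computable_sum computable_mult computable_of_bool decidable_eq
        computable_length computable_code_nth computable_intros)
  from computable_comp[OF this computable_pair[OF that(1) computable_pair[OF that(2,3)]]]
  show ?thesis
    by simp
qed

lemma lookup_weight_exps:
  "Poly_Mapping.lookup (weight \<alpha> (exps U)) y =
     int (\<Sum>l<length U. \<Sum>i<length \<alpha>. \<alpha> ! i * of_bool (U ! l ! i = y))"
proof (induction U)
  case (Cons u U)
  show ?case
    unfolding length_Cons sum.lessThan_Suc_shift
    by (simp add: Cons weight_add weight_frag_of lookup_add lookup_sum lookup_single when_def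
        of_bool_def if_distrib cong: if_cong)
qed simp

lemma degree_at:
  assumes "\<forall>l<length (list_decode c). length (list_decode (code_nth c l)) = length (list_decode a)"
  shows "int (degree_at a y c) =
    Poly_Mapping.lookup (weight (list_decode a) (exps (map list_decode (list_decode c)))) y"
  unfolding lookup_weight_exps degree_at_def of_nat_eq_iff length_map
  by (intro sum.cong refl) (use assms in \<open>simp add: code_nth\<close>)

text \<open>
  Equality of the weights can be tested on the finitely many labels \<open>y \<le> 4 k\<close>, since no other
  label occurs.
\<close>
lemma decidable_balanced:
  "decidable (\<lambda>z. balanced (list_decode (fst (prod_decode z)))
     (4 * length (list_decode (fst (prod_decode z)))) (lhs (snd (prod_decode z))) (rhs (snd (prod_decode z))))"
proof -
  define tuple_list where "tuple_list a c \<longleftrightarrow>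
    (\<forall>l<length (list_decode c). list_decode (code_nth c l)
      \<in> tuples (length (list_decode a)) (4 * length (list_decode a))) \<and>
    length (list_decode c) \<le> 2 * (\<Sum>i<length (list_decode a). code_nth a i) + 2" for a c
  have tuple_list: "tuple_list a c \<longleftrightarrow>
      set (map list_decode (list_decode c)) \<subseteq> tuples (length (list_decode a)) (4 * length (list_decode a)) \<and>
      length (list_decode c) \<le> 2 * sum_list (list_decode a) + 2" for a c
  proof -
    have "(\<Sum>i<length (list_decode a). code_nth a i) = sum_list (list_decode a)"
      by (simp add: sum_list_sum_nth atLeast0LessThan code_nth)
    moreover have "set (map list_decode (list_decode c)) =
        (\<lambda>l. list_decode (code_nth c l)) ` {..<length (list_decode c)}"
      unfolding map_code_nth[symmetric] by auto
    ultimately show ?thesis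
      by (auto simp: tuple_list_def)
  qed
  have "balanced (list_decode a) (4 * length (list_decode a))
      (map list_decode (list_decode c)) (map list_decode (list_decode d)) \<longleftrightarrow>
      tuple_list a c \<and> tuple_list a d \<and>
      (\<forall>y<Suc (4 * length (list_decode a)). degree_at a y c = degree_at a y d)" for a c d
  proof (cases "tuple_list a c \<and> tuple_list a d")
    case True
    let ?w = "\<lambda>c. weight (list_decode a) (exps (map list_decode (list_decode c)))"
    have w: "Poly_Mapping.lookup (?w e) y = int (degree_at a y e)" if "tuple_list a e" for e y
      using that by (intro degree_at[symmetric]) (simp add: tuple_list_def tuples_def)
    have large: "degree_at a y e = 0" if "tuple_list a e" "4 * length (list_decode a) < y" for e y
    proof -
      have "code_nth (code_nth e l) i \<noteq> y"
        if "l < length (list_decode e)" "i < length (list_decode a)" for l i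
      proof -
        have "code_nth (code_nth e l) i \<le> 4 * length (list_decode a)"
          using \<open>tuple_list a e\<close> that unfolding tuple_list_def list_decode_in_tuples_iff by blast
        then show ?thesis
          using \<open>4 * length (list_decode a) < y\<close> by simp
      qed
      then show ?thesis
        by (simp add: degree_at_def)
    qed
    have "?w c = ?w d \<longleftrightarrow> (\<forall>y. degree_at a y c = degree_at a y d)"
      using w True by (simp add: poly_mapping_eq_iff fun_eq_iff)
    also have "\<dots> \<longleftrightarrow> (\<forall>y<Suc (4 * length (list_decode a)). degree_at a y c = degree_at a y d)"
      using large True by (metis less_Suc_eq_le not_less)
    finally show ?thesis
      using True unfolding tuple_list balanced_def by simp
  next
    case False
    then show ?thesis
      unfolding tuple_list balanced_def by auto
  qed
  then show ?thesis
    unfolding lhs_def rhs_def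
    by (simp only: tuple_list_def)
      (intro decidable_conj decidable_all_less decidable_eq decidable_le decidable_tuples
        computable_sum computable_add computable_mult computable_degree_at
        computable_length computable_code_nth computable_intros)
qed

lemma computable_code_bound: "computable (\<lambda>x. code_bound (list_decode x))"
proof -
  have "code_bound (list_decode x) = list_encode (map (\<lambda>_. list_encode (map (\<lambda>_. 4 * length (list_decode x))
      [0..<length (list_decode x)])) [0..<2 * (\<Sum>i<length (list_decode x). code_nth x i) + 2])" for x
  proof -
    have "(\<Sum>i<length (list_decode x). code_nth x i) = sum_list (list_decode x)"
      by (simp add: sum_list_sum_nth atLeast0LessThan code_nth)
    then show ?thesis
      by (simp add: code_bound_def map_replicate_const)
  qed
  then show ?thesis
    by (simp only:) (intro computable_list_encode computable_sum computable_add computable_mult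
        computable_length computable_code_nth computable_intros)
qed

lemma encode_binomial_terms:
  "list_encode (map encode_term (binomial_terms c)) =
     Suc (prod_encode (prod_encode (2, list_encode (map (\<lambda>u. prod_encode (u, 2)) (list_decode (fst (prod_decode c))))),
       Suc (prod_encode (prod_encode (1, list_encode (map (\<lambda>u. prod_encode (u, 2)) (list_decode (snd (prod_decode c))))), 0))))"
  by (simp add: binomial_terms_def encode_term_def lhs_def rhs_def int_encode_def sum_encode_def comp_def)

lemma computable_generator_list:
  "computable (\<lambda>x. encode_output (4 * length (list_decode x)) (generator_list (list_decode x)))"
  unfolding encode_output_def generator_list_def map_map comp_def encode_binomial_terms
  by (intro computable_pair computable_mult computable_list_encode_filter decidable_balanced
      computable_list_map computable_length computable_Suc
      computable_comp[OF computable_code_bound] computable_intros)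

theorem theorem1p7:
  shows "\<exists>P :: prog. \<forall>k\<ge>1. \<forall>d \<alpha>. \<forall>f :: (nat, 'a::field) mpoly.
           length \<alpha> = k \<and> sum_list \<alpha> = d \<and> f = monomial_of \<alpha> \<longrightarrow>
           (let J = (\<lambda>n. laurent_ideal (tuples k n) (toric_ideal k f n))
            in invariant_chain k J \<and>
               (\<exists>N gs. run P (list_encode \<alpha>) (encode_output N gs) \<and>
                       chain_generators k J N (lpoly_of_terms ` set gs)))"
proof -
  obtain P where P: "run P x (encode_output (4 * length (list_decode x)) (generator_list (list_decode x)))" for x
    using computable_generator_list unfolding computable_def by blast
  have "invariant_chain (length \<alpha>) J \<and> (\<exists>N gs. run P (list_encode \<alpha>) (encode_output N gs) \<and>
      chain_generators (length \<alpha>) J N (lpoly_of_terms ` set gs))"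
    if "1 \<le> length \<alpha>"
      and J: "J = (\<lambda>n. laurent_ideal (tuples (length \<alpha>) n) (toric_ideal (length \<alpha>)
        (monomial_of \<alpha> :: (nat, 'a) mpoly) n))" for \<alpha> J
  proof -
    have J: "J = toric_kernel \<alpha>"
      unfolding J by (rule ext) (rule laurent_ideal_toric_ideal)
    have "run P (list_encode \<alpha>) (encode_output (4 * length \<alpha>) (generator_list \<alpha>))"
      using P[of "list_encode \<alpha>"] by simp
    moreover have "chain_generators (length \<alpha>) J (4 * length \<alpha>) (lpoly_of_terms ` set (generator_list \<alpha>))"
      unfolding J set_generator_list by (rule chain_generators_binomials) fact
    ultimately show ?thesis
      using invariant_chain_toric_kernel[of \<alpha>] unfolding J by blast
  qed
  then show ?thesis
    unfolding Let_def by (intro exI[of _ P]) blast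
qed

end
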